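(* Let $\mu$ be a non-negative Radon measure on $\mathbb{R}$ satisfying the Brinck condition, let $\mathbf{H}_\mu$ be the operator generated by the form $\mathbf{a}_\mu$, and let $\lambda_1=\inf\sigma(\mathbf{H}_\mu)$. Then $$-4\,\|q^*_2\|_\infty\ \le\ \lambda_1\ \le\ -\frac14\,\left\|q^*_{(\pi^2+\frac34)^{-1}}\right\|_\infty .$$
   Context: $\Delta_x(d)=[x-\frac d2,x+\frac d2]$. A Radon measure here is a positive Borel measure on $\mathbb{R}$, finite on compact sets (and regular). The Brinck condition: there is $C>0$ with $\mu([x,x+1])<C$ for all $x\in\mathbb{R}$. For $\alpha>0$ the Otelbaev function of $\mu$ is $$q^*_\alpha(x)=\inf\left\{\tfrac1{d^2}:\ d>0,\ \mu(\Delta_x(d))<\tfrac1{\alpha d}\right\};$$ $\|\cdot\|_\infty$ is the supremum norm. The form is $\mathbf{a}_\mu(f,g)=\int_{\mathbb{R}}f'\overline{g'}\,dx-\int_{\mathbb{R}}f\overline{g}\,d\mu$ on $\{f\in H^1(\mathbb{R}):\int|f|^2d\mu<\infty\}$; under the Brinck condition it is densely defined, symmetric, lower semibounded and closed in $L^2(\mathbb{R})$, and $\mathbf{H}_\mu$ is the self-adjoint operator associated with it. It is not assumed that the negative spectrum is discrete or that $\lambda_1$ is an eigenvalue. *)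

theory Defs
  imports "HOL-Analysis.Analysis"
begin

section \<open>Radon measures, the Brinck condition and the Otelbaev function\<close>

definition radon_measure :: "real measure \<Rightarrow> bool" where
  "radon_measure \<mu> \<longleftrightarrow>
     sets \<mu> = sets borel \<and>
     (\<forall>K. compact K \<longrightarrow> emeasure \<mu> K < \<infinity>) \<and>
     (\<forall>A\<in>sets borel. emeasure \<mu> A = (SUP K\<in>{K. compact K \<and> K \<subseteq> A}. emeasure \<mu> K)) \<and>
     (\<forall>A\<in>sets borel. emeasure \<mu> A = (INF U\<in>{U. open U \<and> A \<subseteq> U}. emeasure \<mu> U))"

definition brinck :: "real measure \<Rightarrow> bool" where
  "brinck \<mu> \<longleftrightarrow> (\<exists>C>0. \<forall>x. emeasure \<mu> {x..x + 1} < ennreal C)"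

definition Delta :: "real \<Rightarrow> real \<Rightarrow> real set" where
  "Delta x d = {x - d / 2 .. x + d / 2}"

text \<open>For a Radon measure and \<open>\<alpha> > 0\<close> the set below is nonempty and bounded below by \<open>0\<close>,
  so the real infimum is the intended one.\<close>

definition otelbaev :: "real measure \<Rightarrow> real \<Rightarrow> real \<Rightarrow> real" where
  "otelbaev \<mu> \<alpha> x =
     Inf {1 / d\<^sup>2 | d. 0 < d \<and> emeasure \<mu> (Delta x d) < ennreal (1 / (\<alpha> * d))}"

definition sup_norm :: "(real \<Rightarrow> real) \<Rightarrow> ereal" where
  "sup_norm q = (SUP x. ereal \<bar>q x\<bar>)"


section \<open>The spaces \<open>L\<^sup>2(\<real>)\<close> and \<open>H\<^sup>1(\<real>)\<close>\<close>

text \<open>Elements of \<open>L\<^sup>2(\<real>)\<close> are represented by Borel functions, and equality in \<open>L\<^sup>2(\<real>)\<close> is equality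
  almost everywhere with respect to Lebesgue measure.\<close>

definition L2 :: "(real \<Rightarrow> complex) set" where
  "L2 = {f. f \<in> borel_measurable borel \<and> integrable lborel (\<lambda>x. (cmod (f x))\<^sup>2)}"

definition L2_inner :: "(real \<Rightarrow> complex) \<Rightarrow> (real \<Rightarrow> complex) \<Rightarrow> complex" where
  "L2_inner f g = (LINT x|lborel. f x * cnj (g x))"

definition L2_norm :: "(real \<Rightarrow> complex) \<Rightarrow> real" where
  "L2_norm f = sqrt (LINT x|lborel. (cmod (f x))\<^sup>2)"

text \<open>\<open>H\<^sup>1(\<real>)\<close> consists of the \<open>f \<in> L\<^sup>2(\<real>)\<close> that are locally absolutely continuous, i.e. an indefinite
  Lebesgue integral, with derivative in \<open>L\<^sup>2(\<real>)\<close>. Every class in \<open>H\<^sup>1(\<real>)\<close> is thus represented by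
  its continuous representative; this matters because \<open>\<mu>\<close> may charge Lebesgue null sets.
  The derivative \<open>H1_deriv f\<close> is determined up to a Lebesgue null set.\<close>

definition has_L2_deriv :: "(real \<Rightarrow> complex) \<Rightarrow> (real \<Rightarrow> complex) \<Rightarrow> bool" where
  "has_L2_deriv f g \<longleftrightarrow> g \<in> L2 \<and> (\<forall>a b. a \<le> b \<longrightarrow> f b - f a = (LINT t:{a..b}|lborel. g t))"

definition H1 :: "(real \<Rightarrow> complex) set" where
  "H1 = {f \<in> L2. \<exists>g. has_L2_deriv f g}"

definition H1_deriv :: "(real \<Rightarrow> complex) \<Rightarrow> real \<Rightarrow> complex" where
  "H1_deriv f = (SOME g. has_L2_deriv f g)"


section \<open>The form and the associated operator\<close>

definition form_dom :: "real measure \<Rightarrow> (real \<Rightarrow> complex) set" where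
  "form_dom \<mu> = {f \<in> H1. integrable \<mu> (\<lambda>x. (cmod (f x))\<^sup>2)}"

definition form :: "real measure \<Rightarrow> (real \<Rightarrow> complex) \<Rightarrow> (real \<Rightarrow> complex) \<Rightarrow> complex" where
  "form \<mu> f g = (LINT x|lborel. H1_deriv f x * cnj (H1_deriv g x)) - (LINT x|\<mu>. f x * cnj (g x))"

text \<open>The graph of the operator associated with the form by the first representation theorem:
  \<open>f\<close> is in its domain iff \<open>f\<close> is in the form domain and some \<open>h \<in> L\<^sup>2(\<real>)\<close> satisfies
  \<open>form \<mu> f v = \<langle>h, v\<rangle>\<close> for all \<open>v\<close> in the form domain; \<open>h\<close>, unique up to a null set, is its value.\<close>

definition H_op :: "real measure \<Rightarrow> ((real \<Rightarrow> complex) \<times> (real \<Rightarrow> complex)) set" where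
  "H_op \<mu> = {(f, h). f \<in> form_dom \<mu> \<and> h \<in> L2 \<and> (\<forall>v\<in>form_dom \<mu>. form \<mu> f v = L2_inner h v)}"

text \<open>For an operator \<open>T\<close> in \<open>L\<^sup>2(\<real>)\<close>, given by its graph, \<open>z\<close> is in the resolvent set iff
  \<open>T - z\<close> is injective and onto \<open>L\<^sup>2(\<real>)\<close> and its inverse is bounded.\<close>

definition resolvent_set :: "((real \<Rightarrow> complex) \<times> (real \<Rightarrow> complex)) set \<Rightarrow> complex set" where
  "resolvent_set T = {z.
     (\<forall>(f, h)\<in>T. (AE x in lborel. h x - z * f x = 0) \<longrightarrow> (AE x in lborel. f x = 0)) \<and>
     (\<forall>u\<in>L2. \<exists>(f, h)\<in>T. AE x in lborel. h x - z * f x = u x) \<and>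
     (\<exists>C. \<forall>(f, h)\<in>T. L2_norm f \<le> C * L2_norm (\<lambda>x. h x - z * f x))}"

definition spectrum :: "((real \<Rightarrow> complex) \<times> (real \<Rightarrow> complex)) set \<Rightarrow> complex set" where
  "spectrum T = - resolvent_set T"

text \<open>The operator is self-adjoint, so its spectrum is real and only real points need be considered.
  The infimum is taken in the extended reals, where it is \<open>\<infinity>\<close> for an empty and \<open>-\<infinity>\<close> for an
  unbounded spectrum; finite bounds thus exclude both degenerate cases.\<close>

definition lambda1 :: "real measure \<Rightarrow> ereal" where
  "lambda1 \<mu> = (INF t\<in>{t::real. complex_of_real t \<in> spectrum (H_op \<mu>)}. ereal t)"

end

theory Submission
  imports Defs
begin

text \<open>Lower bound: if \<open>1 / d\<^sup>2\<close> exceeds the supremum of the Otelbaev function for \<open>\<alpha> = 2\<close>, every interval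
  of length \<open>d\<close> has measure less than \<open>1 / (2 d)\<close>. Averaging
  \<open>|f y|\<^sup>2 \<le> 4 |f z|\<^sup>2 + (4/3) |f y - f z|\<^sup>2\<close> over \<open>z\<close> in such an interval and summing over a partition of the
  line gives \<open>\<integral> |f|\<^sup>2 d\<mu> \<le> (2 / d\<^sup>2) \<integral> |f|\<^sup>2 + (2/3) \<integral> |f'|\<^sup>2\<close>. The form shifted by \<open>t < - 2 / d\<^sup>2\<close> is therefore
  coercive on \<open>H\<^sup>1\<close>, and minimising the corresponding functional shows that \<open>t\<close> is in the resolvent set.

  Upper bound: the infimum \<open>m\<close> of the Rayleigh quotient lies in the spectrum. Otherwise
  \<open>g = (H - m)\<^sup>-\<^sup>1 f\<close> depends boundedly on \<open>f\<close>, and the Cauchy-Schwarz inequality for the nonnegative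
  shifted form, applied to \<open>\<parallel>f\<parallel>\<^sup>2 = \<langle>(H - m) g, f\<rangle>\<close>, keeps the Rayleigh quotient of \<open>f\<close> away from \<open>m\<close>.
  The quotient is evaluated at \<open>exp (- |y - x| / d)\<close>, whose square has integral \<open>d\<close>, whose derivative
  has squared norm \<open>1 / d\<close>, and whose square is at least \<open>1 / e\<close> on \<open>Delta x d\<close>.\<close>

section \<open>Square-integrable functions\<close>

text \<open>For \<open>sqint\<close>, \<open>sqn\<close> and \<open>ip\<close> alike the measure is
  a parameter, since the same calculus serves Lebesgue measure and \<open>\<mu>\<close>.\<close>

definition sqint :: "'a measure \<Rightarrow> ('a \<Rightarrow> complex) \<Rightarrow> bool" where
  "sqint M f \<longleftrightarrow> f \<in> borel_measurable M \<and> integrable M (\<lambda>x. (cmod (f x))\<^sup>2)"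

definition sqn :: "'a measure \<Rightarrow> ('a \<Rightarrow> complex) \<Rightarrow> real" where
  "sqn M f = (LINT x|M. (cmod (f x))\<^sup>2)"

definition ip :: "'a measure \<Rightarrow> ('a \<Rightarrow> complex) \<Rightarrow> ('a \<Rightarrow> complex) \<Rightarrow> complex" where
  "ip M f g = (LINT x|M. f x * cnj (g x))"

lemma sqintD: "sqint M f \<Longrightarrow> f \<in> borel_measurable M"
  by (simp add: sqint_def)

lemma L2_iff_sqint: "f \<in> L2 \<longleftrightarrow> sqint lborel f"
  by (simp add: L2_def sqint_def)

lemma sqn_nonneg [simp]: "0 \<le> sqn M f"
  by (simp add: sqn_def)

lemma sqint_nn_integral:
  assumes "sqint M f" shows "(\<integral>\<^sup>+x. ennreal ((cmod (f x))\<^sup>2) \<partial>M) = ennreal (sqn M f)"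
  using assms by (simp add: sqint_def sqn_def nn_integral_eq_integral)

lemma sqintI_nn:
  assumes "f \<in> borel_measurable M" "(\<integral>\<^sup>+x. ennreal ((cmod (f x))\<^sup>2) \<partial>M) \<le> ennreal c" "0 \<le> c"
  shows "sqint M f" "sqn M f \<le> c"
proof -
  have i: "integrable M (\<lambda>x. (cmod (f x))\<^sup>2)"
    using assms by (intro integrableI_nonneg) (auto simp: order_le_less_trans)
  then show s: "sqint M f" using assms by (simp add: sqint_def)
  show "sqn M f \<le> c"
    using assms sqint_nn_integral[OF s] by simp
qed

lemma integrable_mult_cnj:
  assumes "sqint M f" "sqint M g"
  shows "integrable M (\<lambda>x. f x * cnj (g x))"
proof (rule Bochner_Integration.integrable_bound)
  show "integrable M (\<lambda>x. (cmod (f x))\<^sup>2 + (cmod (g x))\<^sup>2)"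
    using assms by (auto simp: sqint_def)
  show "(\<lambda>x. f x * cnj (g x)) \<in> borel_measurable M"
    using assms by (auto simp: sqint_def intro!: borel_measurable_times borel_measurable_continuous_on[of cnj] continuous_intros)
  have "cmod a * cmod b \<le> (cmod a)\<^sup>2 + (cmod b)\<^sup>2" for a b :: complex
  proof -
    have "0 \<le> cmod a * cmod b" by simp
    with sum_squares_bound[of "cmod a" "cmod b"] show ?thesis by linarith
  qed
  then show "AE x in M. norm (f x * cnj (g x)) \<le> norm ((cmod (f x))\<^sup>2 + (cmod (g x))\<^sup>2)"
    by (auto simp: norm_mult)
qed

section \<open>Quadratic expansion and the Cauchy-Schwarz inequality\<close>

lemma cmod_add_mult_sq:
  "(cmod (a + s * b))\<^sup>2 = (cmod a)\<^sup>2 + 2 * Re (cnj s * (a * cnj b)) + (cmod s)\<^sup>2 * (cmod b)\<^sup>2"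
  by (simp only: cmod_power2) (simp add: algebra_simps power2_eq_square)

text \<open>One combination with a complex factor covers sums and differences
  (\<open>s = -1\<close>) and, read as a polynomial in \<open>s\<close>, yields
  Cauchy-Schwarz.\<close>

lemma
  assumes "sqint M f" "sqint M g"
  shows sqint_lin: "sqint M (\<lambda>x. f x + s * g x)"
    and sqn_lin: "sqn M (\<lambda>x. f x + s * g x) = sqn M f + 2 * Re (cnj s * ip M f g) + (cmod s)\<^sup>2 * sqn M g"
proof -
  note [simp] = integrable_mult_cnj[OF assms]
  have i: "integrable M (\<lambda>x. (cmod (f x))\<^sup>2)" "integrable M (\<lambda>x. (cmod (g x))\<^sup>2)"
    using assms by (auto simp: sqint_def)
  note [simp] = i
  show "sqint M (\<lambda>x. f x + s * g x)"
    using assms unfolding sqint_def cmod_add_mult_sq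
    by (intro conjI Bochner_Integration.integrable_add integrable_mult_right integrable_Re) auto
  show "sqn M (\<lambda>x. f x + s * g x) = sqn M f + 2 * Re (cnj s * ip M f g) + (cmod s)\<^sup>2 * sqn M g"
  proof -
    have I: "integrable M (\<lambda>x. cnj s * (f x * cnj (g x)))" by (rule integrable_mult_right) simp
    have "(LINT x|M. 2 * Re (cnj s * (f x * cnj (g x)))) = 2 * Re (cnj s * ip M f g)"
      by (simp only: integral_mult_right_zero integral_Re[OF I] ip_def)
    moreover have "integrable M (\<lambda>x. 2 * Re (cnj s * (f x * cnj (g x))))"
      by (intro integrable_mult_right integrable_Re I)
    ultimately show ?thesis
      unfolding sqn_def cmod_add_mult_sq
      by (simp only: Bochner_Integration.integral_add Bochner_Integration.integrable_add
          i integrable_mult_right integral_mult_right_zero)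
  qed
qed

lemma ip_lin:
  assumes "sqint M f" "sqint M g" "sqint M v"
  shows "ip M (\<lambda>x. f x + s * g x) v = ip M f v + s * ip M g v"
  using integrable_mult_cnj[OF assms(1,3)] integrable_mult_cnj[OF assms(2,3)]
  by (simp add: ip_def ring_distribs mult.assoc)

lemma ip_self: "ip M f f = of_real (sqn M f)"
  by (simp add: ip_def sqn_def complex_norm_square[symmetric] flip: of_real_power)

lemma ip_cong_AE:
  assumes "AE x in M. f x = f' x" "AE x in M. g x = g' x"
    "f \<in> borel_measurable M" "f' \<in> borel_measurable M" "g \<in> borel_measurable M" "g' \<in> borel_measurable M"
  shows "ip M f g = ip M f' g'"
proof -
  have [measurable]: "(\<lambda>x. cnj (g x)) \<in> borel_measurable M" "(\<lambda>x. cnj (g' x)) \<in> borel_measurable M"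
    using assms(5,6) by (auto intro!: borel_measurable_continuous_on[of cnj] continuous_intros)
  show ?thesis unfolding ip_def
    using assms by (intro integral_cong_AE) auto
qed

lemma sqn_cong_AE:
  assumes "AE x in M. f x = f' x" "f \<in> borel_measurable M" "f' \<in> borel_measurable M"
  shows "sqn M f = sqn M f'"
  unfolding sqn_def using assms by (intro integral_cong_AE) auto

lemma sqn_eq_0_iff:
  assumes "sqint M f" shows "sqn M f = 0 \<longleftrightarrow> (AE x in M. f x = 0)"
  using assms by (simp add: sqint_def sqn_def integral_nonneg_eq_0_iff_AE)

text \<open>Common source of Cauchy-Schwarz for \<open>ip\<close> and \<open>shifted_form\<close>,
  and of the residual estimate for minimising sequences. Along \<open>s = - r * \<beta>\<close> with
  real \<open>r\<close> the hypothesis is a real quadratic in \<open>r\<close>, minimal at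
  \<open>r = 1 / n\<close>; for \<open>n = 0\<close> it is affine with slope
  \<open>- 2 * (cmod \<beta>)\<^sup>2\<close>, which forces \<open>\<beta> = 0\<close>.\<close>

lemma quadratic_discriminant_bound:
  fixes \<beta> :: complex and a n :: real
  assumes "0 \<le> n" and nonneg: "\<And>s. 0 \<le> a + 2 * Re (cnj s * \<beta>) + (cmod s)\<^sup>2 * n"
  shows "(cmod \<beta>)\<^sup>2 \<le> a * n"
proof -
  have 1: "0 \<le> a - 2 * r * (cmod \<beta>)\<^sup>2 + r\<^sup>2 * (cmod \<beta>)\<^sup>2 * n" for r :: real
  proof -
    have "Re (cnj (- of_real r * \<beta>) * \<beta>) = - r * (cmod \<beta>)\<^sup>2"
      by (simp only: cmod_power2) (simp add: power2_eq_square algebra_simps)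
    from nonneg[of "- of_real r * \<beta>", unfolded this] show ?thesis
      by (simp add: norm_mult power_mult_distrib mult.assoc)
  qed
  show ?thesis
  proof (cases "n = 0")
    case True
    have "cmod \<beta> = 0"
    proof (rule ccontr)
      assume "cmod \<beta> \<noteq> 0"
      then show False
        using 1[of "(a + 1) / (2 * (cmod \<beta>)\<^sup>2)"] True by (simp add: field_simps)
    qed
    then show ?thesis using True by simp
  next
    case False
    then have "0 < n" using assms by simp
    then show ?thesis using 1[of "1 / n"] by (simp add: field_simps power2_eq_square)
  qed
qed

lemma ip_Cauchy_Schwarz:
  assumes "sqint M f" "sqint M g"
  shows "(cmod (ip M f g))\<^sup>2 \<le> sqn M f * sqn M g"
  by (rule quadratic_discriminant_bound) (use sqn_lin[OF assms, symmetric] in auto)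

lemma cmod_ip_le:
  assumes "sqint M f" "sqint M g"
  shows "cmod (ip M f g) \<le> sqrt (sqn M f) * sqrt (sqn M g)"
  using real_sqrt_le_mono[OF ip_Cauchy_Schwarz[OF assms]] by (simp add: real_sqrt_mult)

lemma L2_norm_eq: "L2_norm f = sqrt (sqn lborel f)"
  by (simp add: L2_norm_def sqn_def)

lemma sqint_indicator:
  assumes "sqint M f" "A \<in> sets M"
  shows "sqint M (\<lambda>x. f x * indicator A x)"
proof -
  have "integrable M (\<lambda>x. (cmod (f x))\<^sup>2 * indicator A x)"
    using assms by (intro integrable_real_mult_indicator) (auto simp: sqint_def)
  moreover have "(\<lambda>x. (cmod (f x * indicator A x))\<^sup>2) = (\<lambda>x. (cmod (f x))\<^sup>2 * indicator A x)"
    by (auto simp: indicator_def)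
  ultimately show ?thesis using assms by (auto simp: sqint_def)
qed

section \<open>Completeness of L^2\<close>

text \<open>A geometric rate is assumed outright because the sequences used below have one. It makes
  the whole sequence, not just a subsequence, converge almost everywhere; \<open>H1_complete\<close>
  relies on that pointwise limit.\<close>

lemma L2_complete:
  fixes F :: "nat \<Rightarrow> 'a \<Rightarrow> complex"
  assumes F: "\<And>n. sqint M (F n)"
    and C: "\<And>n m. n \<le> m \<Longrightarrow> sqn M (\<lambda>x. F n x - F m x) \<le> K / 4 ^ n"
  shows "\<exists>G. sqint M G \<and> (AE x in M. (\<lambda>n. F n x) \<longlonglongrightarrow> G x)
    \<and> (\<forall>n. sqn M (\<lambda>x. F n x - G x) \<le> K / 4 ^ n)"
proof -
  have [measurable]: "F n \<in> borel_measurable M" for n using F by (auto simp: sqint_def)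
  have Fd: "sqint M (\<lambda>x. F n x - F m x)" for n m
    using sqint_lin[OF F F, of n "-1" m] by simp
  have K: "0 \<le> K" using order_trans[OF sqn_nonneg C[of 0 0]] by simp
  \<comment> \<open>The weight \<open>2 ^ n\<close> lies between \<open>1\<close> and the rate
    \<open>4 ^ n\<close>: the integral of \<open>S\<close> is still bounded by a geometric series,
    while finiteness of \<open>S x\<close> gives increments of order
    \<open>(1 / sqrt 2) ^ n\<close>, which are summable.\<close>
  define S where "S x = (\<Sum>n. ennreal (2 ^ n * (cmod (F n x - F (Suc n) x))\<^sup>2))" for x
  have "(\<integral>\<^sup>+x. S x \<partial>M) = (\<Sum>n. \<integral>\<^sup>+x. ennreal (2 ^ n * (cmod (F n x - F (Suc n) x))\<^sup>2) \<partial>M)"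
    unfolding S_def by (rule nn_integral_suminf) measurable
  also have "\<dots> \<le> (\<Sum>n. ennreal (K * (1 / 2) ^ n))"
  proof (intro suminf_le summableI)
    fix n
    have "(\<integral>\<^sup>+x. ennreal (2 ^ n * (cmod (F n x - F (Suc n) x))\<^sup>2) \<partial>M)
        = ennreal (2 ^ n) * ennreal (sqn M (\<lambda>x. F n x - F (Suc n) x))"
      by (subst sqint_nn_integral[OF Fd, symmetric], subst nn_integral_cmult[symmetric])
         (auto simp: ennreal_mult)
    also have "\<dots> \<le> ennreal (2 ^ n) * ennreal (K / 4 ^ n)"
      by (intro mult_left_mono ennreal_leI C) auto
    also have "\<dots> = ennreal (K * (1 / 2) ^ n)"
    proof -
      have "(4::real) ^ n = 2 ^ n * 2 ^ n" by (simp flip: power_mult_distrib)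
      then show ?thesis using K by (simp flip: ennreal_mult add: field_simps)
    qed
    finally show "(\<integral>\<^sup>+x. ennreal (2 ^ n * (cmod (F n x - F (Suc n) x))\<^sup>2) \<partial>M) \<le> ennreal (K * (1 / 2) ^ n)" .
  qed
  also have "\<dots> = ennreal (\<Sum>n. K * (1 / 2) ^ n)"
    using K by (intro suminf_ennreal2) (auto intro!: summable_mult summable_geometric)
  also have "\<dots> < \<infinity>" by simp
  finally have "AE x in M. S x \<noteq> \<infinity>"
    by (intro nn_integral_PInf_AE) (auto simp: S_def)
  then have conv: "AE x in M. convergent (\<lambda>n. F n x)"
  proof eventually_elim
    case (elim x)
    define T where "T = enn2real (S x)"
    have T: "2 ^ n * (cmod (F n x - F (Suc n) x))\<^sup>2 \<le> T" for n
    proof -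
      have "ennreal (2 ^ n * (cmod (F n x - F (Suc n) x))\<^sup>2)
          = (\<Sum>i\<in>{n}. ennreal (2 ^ i * (cmod (F i x - F (Suc i) x))\<^sup>2))" by simp
      also have "\<dots> \<le> S x"
        unfolding S_def by (rule sum_le_suminf) auto
      also have "S x = ennreal T"
        using elim by (simp add: T_def top.not_eq_extremum)
      finally show ?thesis using ennreal_le_iff[of T] by (simp add: T_def)
    qed
    have b: "norm (F (Suc n) x - F n x) \<le> sqrt T * (1 / sqrt 2) ^ n" for n
    proof -
      have "(cmod (F n x - F (Suc n) x))\<^sup>2 \<le> T / 2 ^ n" using T[of n] by (simp add: field_simps)
      then have "cmod (F n x - F (Suc n) x) \<le> sqrt (T / 2 ^ n)" by (rule real_le_rsqrt)
      then show ?thesis by (simp add: norm_minus_commute real_sqrt_divide real_sqrt_power power_divide)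
    qed
    have "summable (\<lambda>n. F (Suc n) x - F n x)"
    proof (rule summable_comparison_test'[where N = 0])
      show "summable (\<lambda>n. sqrt T * (1 / sqrt 2) ^ n)"
        by (intro summable_mult summable_geometric) simp
    qed (use b in auto)
    then have "convergent (\<lambda>n. \<Sum>k<n. F (Suc k) x - F k x)"
      by (simp add: summable_iff_convergent)
    then have "convergent (\<lambda>n. (\<Sum>k<n. F (Suc k) x - F k x) + F 0 x)"
      by (intro convergent_add convergent_const)
    then show "convergent (\<lambda>n. F n x)"
      by (simp only: sum_lessThan_telescope[of "\<lambda>k. F k x"] diff_add_cancel)
  qed
  define G where "G x = lim (\<lambda>n. F n x)" for x
  have [measurable]: "G \<in> borel_measurable M" unfolding G_def by measurable
  have lim: "AE x in M. (\<lambda>n. F n x) \<longlonglongrightarrow> G x"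
    using conv by eventually_elim (simp add: G_def convergent_LIMSEQ_iff)
  have "(\<integral>\<^sup>+x. ennreal ((cmod (F n x - G x))\<^sup>2) \<partial>M) \<le> ennreal (K / 4 ^ n)" for n
  proof -
    have "(\<integral>\<^sup>+x. ennreal ((cmod (F n x - G x))\<^sup>2) \<partial>M)
        = (\<integral>\<^sup>+x. liminf (\<lambda>m. ennreal ((cmod (F n x - F m x))\<^sup>2)) \<partial>M)"
    proof (rule nn_integral_cong_AE, use lim in eventually_elim)
      case (elim x)
      then have "(\<lambda>m. ennreal ((cmod (F n x - F m x))\<^sup>2)) \<longlonglongrightarrow> ennreal ((cmod (F n x - G x))\<^sup>2)"
        by (intro tendsto_intros)
      from lim_imp_Liminf[OF _ this] show ?case by simp
    qed
    \<comment> \<open>Fatou's lemma carries the Cauchy estimate over to the limit.\<close>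
    also have "\<dots> \<le> liminf (\<lambda>m. \<integral>\<^sup>+x. ennreal ((cmod (F n x - F m x))\<^sup>2) \<partial>M)"
      by (rule nn_integral_liminf) measurable
    also have "\<dots> \<le> liminf (\<lambda>m. ennreal (K / 4 ^ n))"
      by (rule Liminf_mono)
        (auto simp: eventually_sequentially sqint_nn_integral[OF Fd] intro!: exI[of _ n] ennreal_leI C)
    finally show ?thesis by (simp add: Liminf_const)
  qed
  from sqintI_nn[OF _ this] K have *: "sqint M (\<lambda>x. F n x - G x)" "sqn M (\<lambda>x. F n x - G x) \<le> K / 4 ^ n" for n
    by auto
  have "sqint M G" using sqint_lin[OF F *(1), of 0 "-1" 0] by simp
  then show ?thesis using lim *(2) by blast
qed

section \<open>The space \<open>H\<^sup>1\<close>\<close>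

lemma sqint_indicator_Icc [simp]: "sqint lborel (indicator {a..b::real} :: real \<Rightarrow> complex)"
proof -
  have "(\<lambda>x. (cmod (indicator {a..b} x))\<^sup>2) = (indicator {a..b} :: real \<Rightarrow> real)"
    by (auto simp: indicator_def)
  then show ?thesis by (simp add: sqint_def integrable_indicator_iff emeasure_lborel_Icc_eq)
qed

lemma sqn_indicator_Icc: "a \<le> b \<Longrightarrow> sqn lborel (indicator {a..b::real} :: real \<Rightarrow> complex) = b - a"
proof -
  assume "a \<le> b"
  have "(\<lambda>x. (cmod (indicator {a..b} x))\<^sup>2) = (indicator {a..b} :: real \<Rightarrow> real)"
    by (auto simp: indicator_def)
  then show ?thesis using \<open>a \<le> b\<close> by (simp add: sqn_def)
qed

lemma set_integral_subset_mono:
  fixes f :: "'a \<Rightarrow> real"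
  assumes "set_integrable M B f" "A \<in> sets M" "A \<subseteq> B" "\<And>x. 0 \<le> f x"
  shows "(LINT x:A|M. f x) \<le> (LINT x:B|M. f x)"
  unfolding set_lebesgue_integral_def
proof (rule integral_mono)
  show "integrable M (\<lambda>x. indicat_real A x *\<^sub>R f x)"
    using set_integrable_subset[OF assms(1-3)] by (simp add: set_integrable_def)
  show "integrable M (\<lambda>x. indicat_real B x *\<^sub>R f x)"
    using assms(1) by (simp add: set_integrable_def)
qed (use assms in \<open>auto simp: indicator_def\<close>)

lemma L2_set_integrable:
  assumes "sqint lborel g" shows "set_integrable lborel {a..b::real} g"
proof -
  have "(\<lambda>x. g x * cnj (indicator {a..b} x)) = (\<lambda>x. indicat_real {a..b} x *\<^sub>R g x)"
    by (auto simp: indicator_def)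
  then show ?thesis
    using integrable_mult_cnj[OF assms sqint_indicator_Icc[of a b]] by (simp add: set_integrable_def)
qed

lemma set_integral_Cauchy_Schwarz:
  assumes g: "sqint lborel g" and "a \<le> b"
  shows "(cmod (LINT t:{a..b::real}|lborel. g t))\<^sup>2 \<le> (b - a) * (LINT t:{a..b}|lborel. (cmod (g t))\<^sup>2)"
proof -
  \<comment> \<open>Cutting \<open>g\<close> off before pairing it with the indicator leaves only
    its norm over \<open>{a..b}\<close> on the right.\<close>
  let ?h = "\<lambda>x. g x * indicator {a..b} x"
  have "(\<lambda>x. ?h x * cnj (indicator {a..b} x)) = (\<lambda>x. indicat_real {a..b} x *\<^sub>R g x)"
    by (auto simp: indicator_def)
  then have "ip lborel ?h (indicator {a..b}) = (LINT t:{a..b}|lborel. g t)"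
    by (simp only: ip_def set_lebesgue_integral_def)
  moreover have "(\<lambda>x. (cmod (?h x))\<^sup>2) = (\<lambda>x. indicat_real {a..b} x *\<^sub>R (cmod (g x))\<^sup>2)"
    by (auto simp: indicator_def)
  then have "sqn lborel ?h = (LINT t:{a..b}|lborel. (cmod (g t))\<^sup>2)"
    by (simp only: sqn_def set_lebesgue_integral_def)
  ultimately show ?thesis
    using ip_Cauchy_Schwarz[OF sqint_indicator[OF g] sqint_indicator_Icc, of "{a..b}" a b] \<open>a \<le> b\<close>
    by (simp add: sqn_indicator_Icc mult.commute)
qed

section \<open>Linearity and uniqueness of the derivative\<close>

lemma has_L2_derivD: "has_L2_deriv f g \<Longrightarrow> sqint lborel g"
  by (simp add: has_L2_deriv_def L2_iff_sqint)

lemma has_L2_deriv_lin: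
  assumes "has_L2_deriv f g" "has_L2_deriv v w"
  shows "has_L2_deriv (\<lambda>x. f x + s * v x) (\<lambda>x. g x + s * w x)"
  unfolding has_L2_deriv_def L2_iff_sqint
proof (intro conjI allI impI)
  note gw = has_L2_derivD[OF assms(1)] has_L2_derivD[OF assms(2)]
  show "sqint lborel (\<lambda>x. g x + s * w x)" by (intro sqint_lin gw)
  fix a b :: real assume "a \<le> b"
  then have "f b - f a = (LINT t:{a..b}|lborel. g t)" "v b - v a = (LINT t:{a..b}|lborel. w t)"
    using assms by (auto simp: has_L2_deriv_def)
  moreover have "(LINT t:{a..b}|lborel. g t + s * w t)
      = (LINT t:{a..b}|lborel. g t) + s * (LINT t:{a..b}|lborel. w t)"
    by (subst set_integral_add) (auto intro!: L2_set_integrable gw set_integrable_mult_right)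
  ultimately show "f b + s * v b - (f a + s * v a) = (LINT t:{a..b}|lborel. g t + s * w t)"
    by (simp add: algebra_simps)
qed

text \<open>Square integrability yields only local integrability, so \<open>h\<close> is first cut
  off to \<open>[-n, n]\<close>. The Borel sets over which the cut-off has integral zero contain the
  intervals and are closed under complements and countable disjoint unions, hence are all Borel
  sets.\<close>

lemma AE_eq_0_of_interval_integrals:
  assumes h: "sqint lborel h" and 0: "\<And>a b::real. a \<le> b \<Longrightarrow> (LINT t:{a..b}|lborel. h t) = 0"
  shows "AE x in lborel. h x = 0"
proof -
  have "AE x in lborel. indicat_real {- real n..real n} x *\<^sub>R h x = 0" for n
  proof (rule sigma_finite_measure.density_zero[OF sigma_finite_lborel])
    let ?I = "{- real n..real n}"
    let ?h = "\<lambda>x. indicat_real ?I x *\<^sub>R h x"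
    show i: "integrable lborel ?h"
      using L2_set_integrable[OF h] by (simp add: set_integrable_def)
    have si: "set_integrable lborel A ?h" if "A \<in> sets borel" for A
      using that unfolding set_integrable_def by (intro integrable_mult_indicator[OF _ i]) simp
    fix A :: "real set" assume "A \<in> sets lborel"
    then have "A \<in> sets borel" by simp
    then show "(LINT x:A|lborel. ?h x) = 0"
    proof (induction rule: borel_set_induct)
      case empty
      then show ?case by (simp add: set_lebesgue_integral_def)
    next
      case (interval a b)
      have "(LINT x:{a..b}|lborel. ?h x) = (LINT x:{max a (- real n)..min b (real n)}|lborel. h x)"
        unfolding set_lebesgue_integral_def
        by (intro Bochner_Integration.integral_cong) (auto simp: indicator_def)
      also have "\<dots> = 0"
        by (cases "max a (- real n) \<le> min b (real n)") (simp_all add: 0, simp add: set_lebesgue_integral_def)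
      finally show ?case .
    next
      case (compl A)
      have "(LINT x:A \<union> - A|lborel. ?h x) = (LINT x:A|lborel. ?h x) + (LINT x:- A|lborel. ?h x)"
        using compl by (intro set_integral_Un si) auto
      moreover have "(LINT x:A \<union> - A|lborel. ?h x) = (LINT x:?I|lborel. h x)"
        by (simp add: set_lebesgue_integral_def)
      ultimately show ?case using compl 0[of "- real n" "real n"] by simp
    next
      case (union f)
      have "(LINT x:(\<Union>i. f i)|lborel. ?h x) = (\<Sum>i. LINT x:f i|lborel. ?h x)"
        using union by (intro lebesgue_integral_countable_add si) (auto simp: disjoint_family_on_def)
      then show ?case using union by simp
    qed
  qed
  then have "AE x in lborel. \<forall>n. indicat_real {- real n..real n} x *\<^sub>R h x = 0"
    unfolding AE_all_countable by blast
  then show ?thesis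
  proof eventually_elim
    case (elim x)
    obtain n where "\<bar>x\<bar> \<le> real n" using real_arch_simple by blast
    then show ?case using elim[rule_format, of n] by (auto simp: indicator_def split: if_splits)
  qed
qed

text \<open>\<open>H1_deriv\<close> is picked by \<open>SOME\<close>; uniqueness almost everywhere
  is what makes it linear up to null sets.\<close>

lemma has_L2_deriv_unique:
  assumes "has_L2_deriv f g" "has_L2_deriv f g'"
  shows "AE x in lborel. g x = g' x"
proof -
  have "has_L2_deriv (\<lambda>x. f x + (-1) * f x) (\<lambda>x. g x + (-1) * g' x)"
    by (rule has_L2_deriv_lin[OF assms])
  then have "AE x in lborel. g x + (-1) * g' x = 0"
    by (intro AE_eq_0_of_interval_integrals) (auto simp: has_L2_deriv_def L2_iff_sqint)
  then show ?thesis by eventually_elim simp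
qed

lemma H1_deriv_has_L2_deriv: "f \<in> H1 \<Longrightarrow> has_L2_deriv f (H1_deriv f)"
  unfolding H1_def H1_deriv_def by (auto intro: someI[of "has_L2_deriv f"])

lemma H1_sqint: "f \<in> H1 \<Longrightarrow> sqint lborel f" "f \<in> H1 \<Longrightarrow> sqint lborel (H1_deriv f)"
  using H1_deriv_has_L2_deriv has_L2_derivD by (auto simp: H1_def L2_iff_sqint)

lemma H1I: "sqint lborel f \<Longrightarrow> has_L2_deriv f g \<Longrightarrow> f \<in> H1"
  by (auto simp: H1_def L2_iff_sqint)

lemma H1_deriv_AE: "has_L2_deriv f g \<Longrightarrow> f \<in> H1 \<Longrightarrow> AE x in lborel. H1_deriv f x = g x"
  by (rule has_L2_deriv_unique[OF H1_deriv_has_L2_deriv])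

lemma H1_lin: "f \<in> H1 \<Longrightarrow> v \<in> H1 \<Longrightarrow> (\<lambda>x. f x + s * v x) \<in> H1"
  by (blast intro: H1I sqint_lin H1_sqint has_L2_deriv_lin H1_deriv_has_L2_deriv)

lemma H1_deriv_lin:
  assumes "f \<in> H1" "v \<in> H1"
  shows "AE x in lborel. H1_deriv (\<lambda>x. f x + s * v x) x = H1_deriv f x + s * H1_deriv v x"
  by (intro H1_deriv_AE has_L2_deriv_lin H1_deriv_has_L2_deriv H1_lin assms)

text \<open>Convergence of the derivatives in L^2 makes all increments \<open>F n b - F n a\<close>
  converge, by Cauchy-Schwarz on \<open>{a..b}\<close>. Convergence at a single point then spreads
  to every point, and the limit is an indefinite integral of \<open>g\<close>.\<close>

lemma H1_complete:
  assumes F: "\<And>n. sqint lborel (F n)" "\<And>n. has_L2_deriv (F n) (G n)"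
    and C: "\<And>n m. n \<le> m \<Longrightarrow> sqn lborel (\<lambda>x. F n x - F m x) \<le> K / 4 ^ n"
       "\<And>n m. n \<le> m \<Longrightarrow> sqn lborel (\<lambda>x. G n x - G m x) \<le> K / 4 ^ n"
  shows "\<exists>f g. sqint lborel f \<and> has_L2_deriv f g
    \<and> (\<forall>n. sqn lborel (\<lambda>x. F n x - f x) \<le> K / 4 ^ n) \<and> (\<forall>n. sqn lborel (\<lambda>x. G n x - g x) \<le> K / 4 ^ n)"
proof -
  have G: "sqint lborel (G n)" for n by (rule has_L2_derivD[OF F(2)])
  obtain g where g: "sqint lborel g" and g2: "\<And>n. sqn lborel (\<lambda>x. G n x - g x) \<le> K / 4 ^ n"
    using L2_complete[OF G C(2)] by blast
  obtain f0 where f0: "sqint lborel f0" and f0_lim: "AE x in lborel. (\<lambda>n. F n x) \<longlonglongrightarrow> f0 x"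
    and f02: "\<And>n. sqn lborel (\<lambda>x. F n x - f0 x) \<le> K / 4 ^ n"
    using L2_complete[OF F(1) C(1)] by blast
  have K0: "(\<lambda>n. K / 4 ^ n) \<longlonglongrightarrow> 0"
    using LIMSEQ_divide_realpow_zero[of 4 K] by simp
  have lim: "(\<lambda>n. F n b - F n a) \<longlonglongrightarrow> (LINT t:{a..b}|lborel. g t)" if "a \<le> b" for a b
  proof -
    have bound: "(cmod ((F n b - F n a) - (LINT t:{a..b}|lborel. g t)))\<^sup>2 \<le> (b - a) * (K / 4 ^ n)" for n
    proof -
      have d: "sqint lborel (\<lambda>t. G n t - g t)" using sqint_lin[OF G g, of n "-1"] by simp
      have "(F n b - F n a) - (LINT t:{a..b}|lborel. g t) = (LINT t:{a..b}|lborel. G n t - g t)"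
        using F(2)[of n] that by (subst set_integral_diff)
          (auto simp: has_L2_deriv_def intro!: L2_set_integrable G g)
      also have "(cmod \<dots>)\<^sup>2 \<le> (b - a) * (LINT t:{a..b}|lborel. (cmod (G n t - g t))\<^sup>2)"
        by (rule set_integral_Cauchy_Schwarz[OF d that])
      also have "(LINT t:{a..b}|lborel. (cmod (G n t - g t))\<^sup>2) \<le> (LINT t:UNIV|lborel. (cmod (G n t - g t))\<^sup>2)"
        using d by (intro set_integral_subset_mono) (auto simp: sqint_def set_integrable_def)
      also have "\<dots> = sqn lborel (\<lambda>t. G n t - g t)" by (simp add: sqn_def set_lebesgue_integral_def)
      also have "\<dots> \<le> K / 4 ^ n" by (rule g2)
      finally show ?thesis using that by (simp add: mult_left_mono)
    qed
    have "(\<lambda>n. (cmod ((F n b - F n a) - (LINT t:{a..b}|lborel. g t)))\<^sup>2) \<longlonglongrightarrow> 0"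
    proof (rule tendsto_sandwich[OF _ _ tendsto_const])
      show "(\<lambda>n. (b - a) * (K / 4 ^ n)) \<longlonglongrightarrow> 0"
        by (rule tendsto_mult_right_zero[OF K0])
    qed (simp, rule always_eventually, rule allI, rule bound)
    from tendsto_real_sqrt[OF this] show ?thesis
      by (simp add: LIM_zero_iff tendsto_norm_zero_iff)
  qed
  \<comment> \<open>A null set is not the whole line, so almost everywhere convergence supplies the
    starting point.\<close>
  obtain c where c: "(\<lambda>n. F n c) \<longlonglongrightarrow> f0 c"
  proof -
    have "ae_filter (lborel :: real measure) \<noteq> bot"
      by (simp add: ae_filter_eq_bot_iff emeasure_lborel_UNIV)
    from eventually_happens'[OF this f0_lim] have "\<exists>c. (\<lambda>n. F n c) \<longlonglongrightarrow> f0 c" .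
    then show ?thesis using that by blast
  qed
  \<comment> \<open>The everywhere limit replaces \<open>f0\<close>, which is fixed only up to a
    null set, because \<open>has_L2_deriv\<close> constrains the value at every point.\<close>
  define f where "f x = lim (\<lambda>n. F n x)" for x
  have "convergent (\<lambda>n. F n x)" for x
  proof (cases "c \<le> x")
    case True
    from tendsto_add[OF lim[OF this] c] show ?thesis by (auto simp: convergent_def)
  next
    case False
    then have "x \<le> c" by simp
    from tendsto_diff[OF c lim[OF this]] show ?thesis by (auto simp: convergent_def)
  qed
  then have f: "(\<lambda>n. F n x) \<longlonglongrightarrow> f x" for x
    by (simp add: f_def convergent_LIMSEQ_iff)
  have fm: "f \<in> borel_measurable lborel"
    by (rule borel_measurable_LIMSEQ_metric[OF sqintD[OF F(1)] f])
  have fmb: "f \<in> borel_measurable borel" using fm by simp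
  have eq: "AE x in lborel. f0 x = f x"
    using f0_lim by eventually_elim (rule LIMSEQ_unique[OF _ f])
  have f0m: "f0 \<in> borel_measurable borel" and Fm: "F n \<in> borel_measurable borel" for n
    using sqintD[OF f0] sqintD[OF F(1)] by simp_all
  have "integrable lborel (\<lambda>x. (cmod (f x))\<^sup>2) \<longleftrightarrow> integrable lborel (\<lambda>x. (cmod (f0 x))\<^sup>2)"
    using eq fmb f0m by (intro integrable_cong_AE) auto
  then have sf: "sqint lborel f" using f0 fm by (simp add: sqint_def)
  have "has_L2_deriv f g"
    unfolding has_L2_deriv_def L2_iff_sqint
  proof (intro conjI allI impI g)
    fix a b :: real assume "a \<le> b"
    show "f b - f a = (LINT t:{a..b}|lborel. g t)"
      by (rule LIMSEQ_unique[OF tendsto_diff[OF f f] lim[OF \<open>a \<le> b\<close>]])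
  qed
  moreover have "sqn lborel (\<lambda>x. F n x - f x) \<le> K / 4 ^ n" for n
  proof -
    have "sqn lborel (\<lambda>x. F n x - f x) = sqn lborel (\<lambda>x. F n x - f0 x)"
      using eq f0m fmb Fm by (intro sqn_cong_AE) auto
    then show ?thesis using f02 by simp
  qed
  ultimately show ?thesis using sf g2 by blast
qed

section \<open>Control of the \<open>\<mu>\<close>-norm by the H^1 norm\<close>

text \<open>Cauchy-Schwarz bounds the oscillation of \<open>f\<close> on the interval by the local
  norm of \<open>g\<close>; averaging over the interval brings in the local norm of
  \<open>f\<close>. The prefactor \<open>2 * d\<close> is kept apart because it later cancels
  against the measure bound \<open>1 / (2 * d)\<close>.\<close>

lemma has_L2_deriv_sq_bound:
  assumes f: "sqint lborel f" and fg: "has_L2_deriv f g" and "0 < d" and y: "y \<in> {a..a + d}"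
  shows "(cmod (f y))\<^sup>2
    \<le> 2 * d * (LINT x:{a..a + d}|lborel. 2 / d\<^sup>2 * (cmod (f x))\<^sup>2 + 2 / 3 * (cmod (g x))\<^sup>2)"
proof -
  define I where "I = {a..a + d}"
  have g: "sqint lborel g" by (rule has_L2_derivD[OF fg])
  have [simp]: "set_integrable lborel I (\<lambda>x. (cmod (g x))\<^sup>2)" "set_integrable lborel I (\<lambda>x. (cmod (f x))\<^sup>2)"
    using f g unfolding sqint_def set_integrable_def I_def
    by (auto intro!: integrable_mult_indicator[where 'b = real, simplified])
  define \<Gamma> where "\<Gamma> = (LINT x:I|lborel. (cmod (g x))\<^sup>2)"
  have osc: "(cmod (f q - f p))\<^sup>2 \<le> d * \<Gamma>" if "p \<in> I" "q \<in> I" "p \<le> q" for p q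
  proof -
    have "f q - f p = (LINT t:{p..q}|lborel. g t)" using fg that by (simp add: has_L2_deriv_def)
    then have "(cmod (f q - f p))\<^sup>2 \<le> (q - p) * (LINT t:{p..q}|lborel. (cmod (g t))\<^sup>2)"
      using set_integral_Cauchy_Schwarz[OF g that(3)] by simp
    also have "\<dots> \<le> d * \<Gamma>"
    proof (intro mult_mono)
      have "{p..q} \<subseteq> I" using that by (auto simp: I_def)
      then show "(LINT t:{p..q}|lborel. (cmod (g t))\<^sup>2) \<le> \<Gamma>"
        unfolding \<Gamma>_def by (intro set_integral_subset_mono) simp_all
      show "0 \<le> (LINT t:{p..q}|lborel. (cmod (g t))\<^sup>2)"
        by (auto simp: set_lebesgue_integral_def intro!: integral_nonneg_AE)
    qed (use that \<open>0 < d\<close> in \<open>auto simp: I_def\<close>)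
    finally show ?thesis .
  qed
  have ptw: "(cmod (f y))\<^sup>2 \<le> 4 * (cmod (f z))\<^sup>2 + 4 / 3 * d * \<Gamma>" if "z \<in> I" for z
  proof -
    have "(cmod (f y - f z))\<^sup>2 \<le> d * \<Gamma>"
    proof (cases "z \<le> y")
      case True
      then show ?thesis using osc[of z y] that y by (simp add: I_def)
    next
      case False
      then show ?thesis using osc[of y z] that y by (simp add: I_def norm_minus_commute)
    qed
    moreover have "(cmod (f y))\<^sup>2 \<le> 4 * (cmod (f z))\<^sup>2 + 4 / 3 * (cmod (f y - f z))\<^sup>2"
    proof -
      have "cmod (f y) \<le> cmod (f z) + cmod (f y - f z)"
        using norm_triangle_ineq[of "f z" "f y - f z"] by simp
      then have "(cmod (f y))\<^sup>2 \<le> (cmod (f z) + cmod (f y - f z))\<^sup>2"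
        by (intro power_mono) auto
      \<comment> \<open>With \<open>p = cmod (f z)\<close> and \<open>q = cmod (f y - f z)\<close>
        the difference of the sides is \<open>(3 * p - q)\<^sup>2 / 3\<close>. The factor
        \<open>4 / 3\<close> ends up as the coefficient \<open>2 / 3 < 1\<close> of the derivative
        term, so that part of this term survives in the form.\<close>
      also have "\<dots> \<le> 4 * (cmod (f z))\<^sup>2 + 4 / 3 * (cmod (f y - f z))\<^sup>2"
        using zero_le_power2[of "3 * cmod (f z) - cmod (f y - f z)"]
        by (simp add: power2_eq_square algebra_simps)
      finally show ?thesis .
    qed
    ultimately show ?thesis by simp
  qed
  have ci: "set_integrable lborel I (\<lambda>z. c)" and cv: "(LINT z:I|lborel. c) = d * c" for c :: real
    using \<open>0 < d\<close> by (simp_all add: I_def set_integrable_def set_lebesgue_integral_def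
      integrable_indicator_iff emeasure_lborel_Icc_eq)
  have "d * (cmod (f y))\<^sup>2 = (LINT z:I|lborel. (cmod (f y))\<^sup>2)"
    by (simp only: cv)
  also have "\<dots> \<le> (LINT z:I|lborel. 4 * (cmod (f z))\<^sup>2 + 4 / 3 * d * \<Gamma>)"
    by (intro set_integral_mono set_integral_add ci ptw) simp_all
  also have "\<dots> = 4 * (LINT z:I|lborel. (cmod (f z))\<^sup>2) + 4 / 3 * d * \<Gamma> * d"
    by (subst set_integral_add) (simp_all add: ci cv)
  also have "\<dots> = 2 * d\<^sup>2 * (2 / d\<^sup>2 * (LINT x:I|lborel. (cmod (f x))\<^sup>2) + 2 / 3 * \<Gamma>)"
    using \<open>0 < d\<close> by (simp add: field_simps power2_eq_square)
  also have "2 / d\<^sup>2 * (LINT x:I|lborel. (cmod (f x))\<^sup>2) + 2 / 3 * \<Gamma>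
      = (LINT x:I|lborel. 2 / d\<^sup>2 * (cmod (f x))\<^sup>2 + 2 / 3 * (cmod (g x))\<^sup>2)"
    unfolding \<Gamma>_def by (subst set_integral_add) (simp_all del: times_divide_eq_left)
  finally show ?thesis using \<open>0 < d\<close> by (simp add: I_def power2_eq_square mult.assoc)
qed

lemma sqn_le_of_small_measure:
  assumes sets: "sets \<mu> = sets borel" and "0 < d"
    and small: "\<And>x. emeasure \<mu> (Delta x d) \<le> ennreal (1 / (2 * d))"
    and f: "sqint lborel f" and fg: "has_L2_deriv f g"
  shows "sqint \<mu> f" "sqn \<mu> f \<le> 2 / d\<^sup>2 * sqn lborel f + 2 / 3 * sqn lborel g"
proof -
  have g: "sqint lborel g" by (rule has_L2_derivD[OF fg])
  define G where "G x = 2 / d\<^sup>2 * (cmod (f x))\<^sup>2 + 2 / 3 * (cmod (g x))\<^sup>2" for x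
  have G0: "0 \<le> G x" for x by (simp add: G_def)
  have Gi: "integrable lborel G" using f g unfolding G_def by (auto simp: sqint_def)
  have [measurable]: "f \<in> borel_measurable borel" "g \<in> borel_measurable borel"
    using f g by (auto simp: sqint_def)
  have f\<mu> [measurable]: "f \<in> borel_measurable \<mu>" by (simp add: measurable_cong_sets[OF sets refl])
  have [measurable]: "G \<in> borel_measurable borel" unfolding G_def by measurable
  \<comment> \<open>Half-open cells are disjoint, so an atom of \<open>\<mu>\<close> on a cell
    boundary is counted once. The estimates use the closed cell: its extra endpoint only enlarges
    the upper bound on the \<open>\<mu>\<close> side and is Lebesgue null on the other.\<close>
  define X where "X k = {of_int k * d..<of_int k * d + d}" for k :: int
  have X: "X k \<in> sets borel" for k by (simp add: X_def)
  have UX: "(\<Union>k. X k) = UNIV"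
  proof -
    have "x \<in> X \<lfloor>x / d\<rfloor>" for x
      using pos_le_divide_eq[THEN iffD1, OF \<open>0 < d\<close> of_int_floor_le]
        pos_divide_less_eq[THEN iffD1, OF \<open>0 < d\<close> real_of_int_floor_add_one_gt]
      by (simp add: X_def distrib_right)
    then show ?thesis by blast
  qed
  have disj: "disjoint_family_on X UNIV"
  proof -
    have "k = \<lfloor>x / d\<rfloor>" if "x \<in> X k" for k x
      using that \<open>0 < d\<close> by (intro floor_unique[symmetric]) (auto simp: X_def field_simps)
    then show ?thesis unfolding disjoint_family_on_def by blast
  qed
  \<comment> \<open>Both sides are values of density measures, so countable additivity sums the
    cells before integrability with respect to \<open>\<mu>\<close> is known.\<close>
  have cell: "emeasure (density \<mu> (\<lambda>x. ennreal ((cmod (f x))\<^sup>2))) (X k)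
      \<le> emeasure (density lborel (\<lambda>x. ennreal (G x))) (X k)" for k
  proof -
    define a where "a = of_int k * d"
    define S where "S = (LINT x:{a..a + d}|lborel. G x)"
    have S0: "0 \<le> S" unfolding S_def set_lebesgue_integral_def
      by (intro integral_nonneg_AE) (auto simp: G0)
    have "emeasure (density \<mu> (\<lambda>x. ennreal ((cmod (f x))\<^sup>2))) (X k)
        = (\<integral>\<^sup>+x. ennreal ((cmod (f x))\<^sup>2) * indicator (X k) x \<partial>\<mu>)"
      by (rule emeasure_density) (use X sets in auto)
    also have "\<dots> \<le> (\<integral>\<^sup>+x. ennreal (2 * d * S) * indicator {a..a + d} x \<partial>\<mu>)"
      using has_L2_deriv_sq_bound[OF f fg \<open>0 < d\<close>, of _ a]
      by (intro nn_integral_mono) (auto simp: X_def a_def S_def G_def indicator_def intro!: ennreal_leI)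
    also have "\<dots> = ennreal (2 * d * S) * emeasure \<mu> {a..a + d}"
      using sets by (intro nn_integral_cmult_indicator) simp
    also have "\<dots> \<le> ennreal (2 * d * S) * ennreal (1 / (2 * d))"
    proof (rule mult_left_mono)
      have "Delta (a + d / 2) d = {a..a + d}" by (auto simp: Delta_def)
      then show "emeasure \<mu> {a..a + d} \<le> ennreal (1 / (2 * d))" using small[of "a + d / 2"] by simp
    qed simp
    also have "\<dots> = ennreal S" using \<open>0 < d\<close> S0 by (simp flip: ennreal_mult)
    also have "\<dots> = (\<integral>\<^sup>+x. ennreal (indicator {a..a + d} x *\<^sub>R G x) \<partial>lborel)"
      unfolding S_def set_lebesgue_integral_def
      by (rule nn_integral_eq_integral[symmetric]) (auto intro!: integrable_real_mult_indicator Gi simp: G0 mult.commute)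
    also have "\<dots> = (\<integral>\<^sup>+x. ennreal (G x) * indicator (X k) x \<partial>lborel)"
    proof (rule nn_integral_cong_AE)
      show "AE x in lborel. ennreal (indicator {a..a + d} x *\<^sub>R G x) = ennreal (G x) * indicator (X k) x"
        using AE_lborel_singleton[of "a + d"]
        by eventually_elim (auto simp: X_def a_def indicator_def)
    qed
    also have "\<dots> = emeasure (density lborel (\<lambda>x. ennreal (G x))) (X k)"
      by (rule emeasure_density[symmetric]) (use X in auto)
    finally show ?thesis .
  qed
  have "(\<integral>\<^sup>+x. ennreal ((cmod (f x))\<^sup>2) \<partial>\<mu>)
      = emeasure (density \<mu> (\<lambda>x. ennreal ((cmod (f x))\<^sup>2))) (\<Union>k. X k)"
    by (simp add: UX emeasure_density sets)
  also have "\<dots> = (\<integral>\<^sup>+k. emeasure (density \<mu> (\<lambda>x. ennreal ((cmod (f x))\<^sup>2))) (X k) \<partial>count_space UNIV)"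
    by (rule emeasure_UN_countable) (use X sets disj in auto)
  also have "\<dots> \<le> (\<integral>\<^sup>+k. emeasure (density lborel (\<lambda>x. ennreal (G x))) (X k) \<partial>count_space UNIV)"
    by (intro nn_integral_mono cell)
  also have "\<dots> = emeasure (density lborel (\<lambda>x. ennreal (G x))) (\<Union>k. X k)"
    by (rule emeasure_UN_countable[symmetric]) (use X disj in auto)
  also have "\<dots> = (\<integral>\<^sup>+x. ennreal (G x) \<partial>lborel)"
    by (simp add: UX emeasure_density)
  also have "\<dots> = ennreal (LINT x|lborel. G x)"
    by (rule nn_integral_eq_integral) (auto simp: Gi G0)
  also have "(LINT x|lborel. G x) = 2 / d\<^sup>2 * sqn lborel f + 2 / 3 * sqn lborel g"
    using f g unfolding G_def sqn_def sqint_def by (subst Bochner_Integration.integral_add) auto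
  finally have *: "(\<integral>\<^sup>+x. ennreal ((cmod (f x))\<^sup>2) \<partial>\<mu>) \<le> ennreal (2 / d\<^sup>2 * sqn lborel f + 2 / 3 * sqn lborel g)" .
  show "sqint \<mu> f" "sqn \<mu> f \<le> 2 / d\<^sup>2 * sqn lborel f + 2 / 3 * sqn lborel g"
    using sqintI_nn[OF f\<mu> *] by auto
qed

lemma ip_lin_right:
  assumes "sqint M f" "sqint M g" "sqint M u"
  shows "ip M u (\<lambda>x. f x + s * g x) = ip M u f + cnj s * ip M u g"
  using integrable_mult_cnj[OF assms(3,1)] integrable_mult_cnj[OF assms(3,2)]
  by (simp add: ip_def ring_distribs mult.left_commute)

section \<open>Form and spectrum\<close>

text \<open>Isolates what the operator theory uses about \<open>\<mu>\<close>: the form domain is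
  all of H^1. Under the Brinck condition \<open>sqn_le_of_small_measure\<close> supplies
  this.\<close>

locale H1_form =
  fixes \<mu> :: "real measure"
  assumes H1_sqint_measure: "f \<in> H1 \<Longrightarrow> sqint \<mu> f"
begin

lemma form_dom_eq: "form_dom \<mu> = H1"
  using H1_sqint_measure by (auto simp: form_dom_def sqint_def)

text \<open>The quadratic form of the operator shifted by \<open>t\<close>;
  \<open>energy 0 f / sqn lborel f\<close> is the Rayleigh quotient.\<close>

definition energy :: "real \<Rightarrow> (real \<Rightarrow> complex) \<Rightarrow> real" where
  "energy t f = sqn lborel (H1_deriv f) - sqn \<mu> f - t * sqn lborel f"

definition shifted_form :: "real \<Rightarrow> (real \<Rightarrow> complex) \<Rightarrow> (real \<Rightarrow> complex) \<Rightarrow> complex" where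
  "shifted_form t f v = form \<mu> f v - of_real t * ip lborel f v"

lemma form_eq: "form \<mu> f v = ip lborel (H1_deriv f) (H1_deriv v) - ip \<mu> f v"
  by (simp add: form_def ip_def)

lemmas sqints = H1_sqint H1_sqint_measure

lemma measurable_H1:
  "f \<in> H1 \<Longrightarrow> f \<in> borel_measurable lborel" "f \<in> H1 \<Longrightarrow> H1_deriv f \<in> borel_measurable lborel"
  using H1_sqint[of f] by (auto dest: sqintD)

lemma sqn_H1_deriv_lin:
  assumes "f \<in> H1" "v \<in> H1"
  shows "sqn lborel (H1_deriv (\<lambda>x. f x + s * v x)) = sqn lborel (\<lambda>x. H1_deriv f x + s * H1_deriv v x)"
  by (intro sqn_cong_AE H1_deriv_lin measurable_H1 H1_lin sqintD sqint_lin sqints assms)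

lemma energy_lin:
  assumes "f \<in> H1" "v \<in> H1"
  shows "energy t (\<lambda>x. f x + s * v x)
    = energy t f + 2 * Re (cnj s * shifted_form t f v) + (cmod s)\<^sup>2 * energy t v"
  unfolding energy_def shifted_form_def form_eq sqn_H1_deriv_lin[OF assms]
  by (simp add: sqn_lin sqints assms) (simp add: algebra_simps)

lemma shifted_form_lin:
  assumes "f \<in> H1" "v \<in> H1" "w \<in> H1"
  shows "shifted_form t (\<lambda>x. f x + s * v x) w = shifted_form t f w + s * shifted_form t v w"
proof -
  have "ip lborel (H1_deriv (\<lambda>x. f x + s * v x)) (H1_deriv w)
      = ip lborel (\<lambda>x. H1_deriv f x + s * H1_deriv v x) (H1_deriv w)"
    by (intro ip_cong_AE H1_deriv_lin measurable_H1 H1_lin sqintD[OF sqint_lin] sqints assms AE_I2 refl)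
  then show ?thesis
    by (simp add: shifted_form_def form_eq ip_lin sqints assms) (simp add: algebra_simps)
qed

lemma shifted_form_self: "shifted_form t f f = of_real (energy t f)"
  by (simp add: shifted_form_def form_eq ip_self energy_def)

lemma shifted_form_Cauchy_Schwarz:
  assumes "\<And>f. f \<in> H1 \<Longrightarrow> 0 \<le> energy t f" "f \<in> H1" "v \<in> H1"
  shows "(cmod (shifted_form t f v))\<^sup>2 \<le> energy t f * energy t v"
proof (rule quadratic_discriminant_bound)
  show "0 \<le> energy t f + 2 * Re (cnj s * shifted_form t f v) + (cmod s)\<^sup>2 * energy t v" for s
    using assms(1)[OF H1_lin[OF assms(2,3)]] by (simp add: energy_lin assms)
qed (use assms in auto)

text \<open>Existence of \<open>f\<close> by the direct method: a sequence minimising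
  \<open>v \<mapsto> energy t v - 2 Re \<langle>u, v\<rangle>\<close> is Cauchy in \<open>H\<^sup>1\<close> by the parallelogram law.\<close>

lemma coercive_form_solvable:
  assumes "0 < c"
    and coercive: "\<And>f. f \<in> H1 \<Longrightarrow> c * (sqn lborel (H1_deriv f) + sqn lborel f) \<le> energy t f"
    and u: "sqint lborel u"
  shows "\<exists>f\<in>H1. \<forall>v\<in>H1. shifted_form t f v = ip lborel u v"
proof -
  have pos: "0 \<le> energy t f" if "f \<in> H1" for f
    using coercive[OF that] \<open>0 < c\<close> by (smt (verit) mult_nonneg_nonneg sqn_nonneg)
  define J where "J v = energy t v - 2 * Re (ip lborel u v)" for v
  have J_lin: "J (\<lambda>x. f x + s * v x)
      = J f + 2 * Re (cnj s * (shifted_form t f v - ip lborel u v)) + (cmod s)\<^sup>2 * energy t v"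
    if "f \<in> H1" "v \<in> H1" for f v s
    unfolding J_def by (simp add: energy_lin ip_lin_right that sqints u) (simp add: algebra_simps)
  have J_ge: "- sqn lborel u / c \<le> J v" if "v \<in> H1" for v
  proof -
    \<comment> \<open>Completing the square in L^2: the linear term of \<open>J\<close> is absorbed
      by \<open>c * sqn lborel v\<close>, which coercivity provides.\<close>
    have "0 \<le> sqn lborel (\<lambda>x. u x + of_real (- c) * v x)" by simp
    also have "\<dots> = sqn lborel u - 2 * c * Re (ip lborel u v) + c\<^sup>2 * sqn lborel v"
      by (subst sqn_lin) (simp_all add: u sqints that)
    finally have "- sqn lborel u \<le> c * (c * sqn lborel v - 2 * Re (ip lborel u v))"
      by (simp add: power2_eq_square algebra_simps)
    also have "\<dots> \<le> c * J v"
      unfolding J_def using coercive[OF that] \<open>0 < c\<close>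
      by (intro mult_left_mono) (smt (verit) mult_nonneg_nonneg sqn_nonneg distrib_left, simp)
    finally show ?thesis using \<open>0 < c\<close> by (simp add: field_simps)
  qed
  define j where "j = Inf (J ` H1)"
  have bdd: "bdd_below (J ` H1)" using J_ge by (auto intro!: bdd_belowI2)
  have H1_ne: "H1 \<noteq> {}"
  proof -
    have "(\<lambda>x. 0) \<in> H1"
      by (rule H1I[of _ "\<lambda>x. 0"]) (auto simp: sqint_def has_L2_deriv_def L2_def set_lebesgue_integral_def)
    then show ?thesis by blast
  qed
  have j_le: "j \<le> J v" if "v \<in> H1" for v
    unfolding j_def using bdd that by (simp add: cINF_lower)
  have "\<exists>f\<in>H1. J f < j + 1 / 4 ^ n" for n :: nat
    using cInf_lessD[of "J ` H1" "j + 1 / 4 ^ n"] H1_ne by (auto simp: j_def)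
  then obtain F where F: "\<And>n. F n \<in> H1" and JF: "\<And>n. J (F n) < j + 1 / 4 ^ n" by metis
  have cauchy: "energy t (\<lambda>x. F n x + (-1) * F m x) \<le> 4 / 4 ^ n" if "n \<le> m" for n m
  proof -
    let ?w = "\<lambda>x. F n x + (-1) * F m x"
    have w: "?w \<in> H1" by (intro H1_lin F)
    have "J (F m) = J (\<lambda>x. F n x + (-1) * ?w x)" by simp
    also have "\<dots> = J (F n) - 2 * Re (shifted_form t (F n) ?w - ip lborel u ?w) + energy t ?w"
      by (subst J_lin[OF F w]) simp
    finally have 1: "J (F m) = J (F n) - 2 * Re (shifted_form t (F n) ?w - ip lborel u ?w) + energy t ?w" .
    \<comment> \<open>The factor \<open>- (1 / 2)\<close> leads to the midpoint of
      \<open>F n\<close> and \<open>F m\<close>. Eliminating the linear term between this expansion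
      and \<open>1\<close> gives the parallelogram law.\<close>
    have "j \<le> J (\<lambda>x. F n x + (- (1 / 2)) * ?w x)" by (intro j_le H1_lin F)
    also have "\<dots> = J (F n) - Re (shifted_form t (F n) ?w - ip lborel u ?w) + energy t ?w / 4"
      by (subst J_lin[OF F w]) (simp add: power2_eq_square diff_divide_distrib)
    finally have "energy t ?w \<le> 2 * (J (F n) + J (F m) - 2 * j)" using 1 by simp
    moreover have "(1::real) / 4 ^ m \<le> 1 / 4 ^ n"
      using that by (intro divide_left_mono power_increasing) auto
    ultimately show ?thesis using JF[of n] JF[of m] by simp
  qed
  have "sqn lborel (H1_deriv (\<lambda>x. F n x + (-1) * F m x)) + sqn lborel (\<lambda>x. F n x + (-1) * F m x)
      \<le> (4 / c) / 4 ^ n" if "n \<le> m" for n m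
    using order_trans[OF coercive[OF H1_lin[OF F F]] cauchy[OF that]] \<open>0 < c\<close>
    by (simp add: field_simps)
  then have sum_le: "sqn lborel (\<lambda>x. H1_deriv (F n) x - H1_deriv (F m) x) + sqn lborel (\<lambda>x. F n x - F m x)
      \<le> (4 / c) / 4 ^ n" if "n \<le> m" for n m
    using sqn_H1_deriv_lin[OF F F, of n "-1" m] that by fastforce
  have C1: "sqn lborel (\<lambda>x. F n x - F m x) \<le> (4 / c) / 4 ^ n"
    and C2: "sqn lborel (\<lambda>x. H1_deriv (F n) x - H1_deriv (F m) x) \<le> (4 / c) / 4 ^ n" if "n \<le> m" for n m
    using sum_le[OF that] sqn_nonneg[of lborel "\<lambda>x. F n x - F m x"]
      sqn_nonneg[of lborel "\<lambda>x. H1_deriv (F n) x - H1_deriv (F m) x"] by linarith+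
  obtain f g where f: "sqint lborel f" and fg: "has_L2_deriv f g"
    and f_lim: "\<And>n. sqn lborel (\<lambda>x. F n x - f x) \<le> (4 / c) / 4 ^ n"
    and g_lim: "\<And>n. sqn lborel (\<lambda>x. H1_deriv (F n) x - g x) \<le> (4 / c) / 4 ^ n"
    using H1_complete[OF H1_sqint(1)[OF F] H1_deriv_has_L2_deriv[OF F] C1 C2] by blast
  have fH1: "f \<in> H1" by (rule H1I[OF f fg])
  \<comment> \<open>The sign of \<open>t\<close> is open, hence its absolute value; the
    \<open>\<mu>\<close> term enters \<open>energy\<close> with a minus sign and is dropped from the
    upper bound.\<close>
  define K where "K = (1 + \<bar>t\<bar>) * (4 / c)"
  have e_lim: "energy t (\<lambda>x. F n x + (-1) * f x) \<le> K / 4 ^ n" for n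
  proof -
    have "sqn lborel (H1_deriv (\<lambda>x. F n x + (-1) * f x)) = sqn lborel (\<lambda>x. H1_deriv (F n) x - g x)"
    proof (rule sqn_cong_AE)
      show "AE x in lborel. H1_deriv (\<lambda>x. F n x + (-1) * f x) x = H1_deriv (F n) x - g x"
        using H1_deriv_lin[OF F fH1, of n "-1"] H1_deriv_AE[OF fg fH1]
        by eventually_elim simp
      show "(\<lambda>x. H1_deriv (F n) x - g x) \<in> borel_measurable lborel"
        using sqintD[OF H1_sqint(2)[OF F]] sqintD[OF has_L2_derivD[OF fg]]
        by (intro borel_measurable_diff)
    qed (intro measurable_H1 H1_lin F fH1)
    moreover have "- t * sqn lborel (\<lambda>x. F n x - f x) \<le> \<bar>t\<bar> * sqn lborel (\<lambda>x. F n x - f x)"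
      by (intro mult_right_mono) auto
    moreover have "\<bar>t\<bar> * sqn lborel (\<lambda>x. F n x - f x) \<le> \<bar>t\<bar> * ((4 / c) / 4 ^ n)"
      by (intro mult_left_mono f_lim) auto
    moreover have "energy t (\<lambda>x. F n x + (-1) * f x) = sqn lborel (H1_deriv (\<lambda>x. F n x + (-1) * f x))
        - sqn \<mu> (\<lambda>x. F n x - f x) - t * sqn lborel (\<lambda>x. F n x - f x)"
      by (simp add: energy_def)
    ultimately have "energy t (\<lambda>x. F n x + (-1) * f x) \<le> (4 / c) / 4 ^ n + \<bar>t\<bar> * ((4 / c) / 4 ^ n)"
      using g_lim[of n] sqn_nonneg[of \<mu> "\<lambda>x. F n x - f x"] by linarith
    then show ?thesis by (simp add: K_def distrib_right add_divide_distrib)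
  qed
  have "shifted_form t f v = ip lborel u v" if v: "v \<in> H1" for v
  proof -
    have lim0: "(\<lambda>n. X n) \<longlonglongrightarrow> 0" if "\<And>n. (cmod (X n))\<^sup>2 \<le> L / 4 ^ n" for X L
    proof -
      have "(\<lambda>n. (cmod (X n))\<^sup>2) \<longlonglongrightarrow> 0"
        by (rule tendsto_sandwich[OF _ _ tendsto_const LIMSEQ_divide_realpow_zero[of 4 L]]) (use that in auto)
      from tendsto_real_sqrt[OF this] show ?thesis by (simp add: tendsto_norm_zero_iff)
    qed
    \<comment> \<open>\<open>F n\<close> misses the infimum of \<open>J\<close> by at most
      \<open>1 / 4 ^ n\<close>, so adding that error makes the expansion along \<open>v\<close> a
      nonnegative polynomial in \<open>s\<close>, whose discriminant bounds the residual. The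
      equation for \<open>f\<close> is the limit of these approximate equations.\<close>
    have "(cmod (shifted_form t (F n) v - ip lborel u v))\<^sup>2 \<le> 1 / 4 ^ n * energy t v" for n
    proof (rule quadratic_discriminant_bound[OF pos[OF v]])
      fix s
      have "j \<le> J (\<lambda>x. F n x + s * v x)" by (intro j_le H1_lin F v)
      then show "0 \<le> 1 / 4 ^ n + 2 * Re (cnj s * (shifted_form t (F n) v - ip lborel u v)) + (cmod s)\<^sup>2 * energy t v"
        using J_lin[OF F v, of n s] JF[of n] by linarith
    qed
    then have 1: "(\<lambda>n. shifted_form t (F n) v - ip lborel u v) \<longlonglongrightarrow> 0"
      by (intro lim0[of _ "energy t v"]) simp
    have "(cmod (shifted_form t (F n) v - shifted_form t f v))\<^sup>2 \<le> (K * energy t v) / 4 ^ n" for n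
    proof -
      have "shifted_form t (F n) v - shifted_form t f v = shifted_form t (\<lambda>x. F n x + (-1) * f x) v"
        by (subst shifted_form_lin[OF F fH1 v]) simp
      then have "(cmod (shifted_form t (F n) v - shifted_form t f v))\<^sup>2
          \<le> energy t (\<lambda>x. F n x + (-1) * f x) * energy t v"
        using shifted_form_Cauchy_Schwarz[OF pos H1_lin[OF F fH1] v, of n "-1"] by simp
      also have "\<dots> \<le> K / 4 ^ n * energy t v"
        by (intro mult_right_mono e_lim pos v)
      finally show ?thesis by simp
    qed
    then have "(\<lambda>n. shifted_form t (F n) v - shifted_form t f v) \<longlonglongrightarrow> 0" by (rule lim0)
    from tendsto_diff[OF 1 this] show ?thesis by (simp add: LIMSEQ_const_iff)
  qed
  with fH1 show ?thesis by blast
qed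

section \<open>The operator and its resolvent set\<close>

lemma H_op_iff:
  "(f, h) \<in> H_op \<mu> \<longleftrightarrow> f \<in> H1 \<and> sqint lborel h \<and> (\<forall>v\<in>H1. form \<mu> f v = ip lborel h v)"
  by (simp add: H_op_def form_dom_eq L2_iff_sqint L2_inner_def ip_def)

lemma H_op_shifted:
  assumes "(f, h) \<in> H_op \<mu>"
  shows "sqint lborel (\<lambda>x. h x - of_real t * f x)"
    "v \<in> H1 \<Longrightarrow> shifted_form t f v = ip lborel (\<lambda>x. h x - of_real t * f x) v"
proof -
  have *: "f \<in> H1" "sqint lborel h" "\<forall>v\<in>H1. form \<mu> f v = ip lborel h v"
    using assms by (auto simp: H_op_iff)
  show "sqint lborel (\<lambda>x. h x - of_real t * f x)"
    using sqint_lin[OF *(2) H1_sqint(1)[OF *(1)], of "- of_real t"] by simp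
  show "shifted_form t f v = ip lborel (\<lambda>x. h x - of_real t * f x) v" if "v \<in> H1"
    using ip_lin[OF *(2) H1_sqint(1)[OF *(1)] H1_sqint(1)[OF that], of "- of_real t"] that *(3)
    by (simp add: shifted_form_def)
qed

text \<open>Testing the equation with \<open>f\<close> itself bounds the inverse by
  \<open>1 / c\<close>. Injectivity is the case of a vanishing right-hand side, and surjectivity is
  \<open>coercive_form_solvable\<close>.\<close>

lemma coercive_imp_resolvent_set:
  assumes "0 < c"
    and coercive: "\<And>f. f \<in> H1 \<Longrightarrow> c * (sqn lborel (H1_deriv f) + sqn lborel f) \<le> energy t f"
  shows "complex_of_real t \<in> resolvent_set (H_op \<mu>)"
proof -
  have bound: "L2_norm f \<le> 1 / c * L2_norm (\<lambda>x. h x - of_real t * f x)" if fh: "(f, h) \<in> H_op \<mu>" for f h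
  proof -
    let ?k = "\<lambda>x. h x - of_real t * f x"
    have f: "f \<in> H1" using fh by (simp add: H_op_iff)
    have "c * sqn lborel f \<le> c * (sqn lborel (H1_deriv f) + sqn lborel f)"
      using \<open>0 < c\<close> by (intro mult_left_mono) auto
    also have "\<dots> \<le> energy t f" by (rule coercive[OF f])
    also have "\<dots> = Re (ip lborel ?k f)"
      using H_op_shifted(2)[OF fh f, of t] by (metis Re_complex_of_real shifted_form_self)
    also have "\<dots> \<le> cmod (ip lborel ?k f)" by (rule complex_Re_le_cmod)
    also have "\<dots> \<le> L2_norm ?k * L2_norm f"
      unfolding L2_norm_eq by (rule cmod_ip_le[OF H_op_shifted(1)[OF fh] H1_sqint(1)[OF f]])
    finally have "c * (L2_norm f * L2_norm f) \<le> L2_norm ?k * L2_norm f"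
      by (simp add: L2_norm_eq)
    moreover have "0 \<le> L2_norm f" "0 \<le> L2_norm ?k" by (auto simp: L2_norm_eq)
    ultimately have "c * L2_norm f \<le> L2_norm ?k"
      by (cases "L2_norm f = 0") (auto simp flip: mult.assoc)
    then show ?thesis using \<open>0 < c\<close> by (simp add: field_simps)
  qed
  have inj: "AE x in lborel. f x = 0"
    if fh: "(f, h) \<in> H_op \<mu>" and 0: "AE x in lborel. h x - of_real t * f x = 0" for f h
  proof -
    have f: "sqint lborel f" using fh by (simp add: H_op_iff H1_sqint)
    have "sqn lborel (\<lambda>x. h x - of_real t * f x) = 0"
      using 0 sqn_eq_0_iff[OF H_op_shifted(1)[OF fh]] by blast
    then have "sqn lborel f = 0" using bound[OF fh] sqn_nonneg[of lborel f] by (simp add: L2_norm_eq)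
    then show ?thesis using sqn_eq_0_iff[OF f] by blast
  qed
  have surj: "\<exists>(f, h)\<in>H_op \<mu>. AE x in lborel. h x - of_real t * f x = u x" if "u \<in> L2" for u
  proof -
    have u: "sqint lborel u" using that by (simp add: L2_iff_sqint)
    obtain f where f: "f \<in> H1" and fv: "\<And>v. v \<in> H1 \<Longrightarrow> shifted_form t f v = ip lborel u v"
      using coercive_form_solvable[OF assms u] by blast
    have "(f, \<lambda>x. u x + of_real t * f x) \<in> H_op \<mu>"
      unfolding H_op_iff
    proof (intro conjI ballI)
      fix v assume v: "v \<in> H1"
      show "form \<mu> f v = ip lborel (\<lambda>x. u x + of_real t * f x) v"
        using fv[OF v] by (simp add: ip_lin u f v H1_sqint shifted_form_def diff_eq_eq)
    qed (intro f sqint_lin u H1_sqint)+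
    then show ?thesis by (intro bexI[of _ "(f, \<lambda>x. u x + of_real t * f x)"]) auto
  qed
  show ?thesis
    unfolding resolvent_set_def using bound inj surj by blast
qed

section \<open>The bottom of the spectrum\<close>

text \<open>The infimum need not be attained, so near-minimisers take the place of an
  eigenfunction.\<close>

lemma approximate_minimum_in_spectrum:
  assumes nonneg: "\<And>f. f \<in> H1 \<Longrightarrow> 0 \<le> energy m f"
    and approx: "\<And>\<delta>. 0 < \<delta> \<Longrightarrow> \<exists>f\<in>H1. 0 < sqn lborel f \<and> energy m f \<le> \<delta> * sqn lborel f"
  shows "complex_of_real m \<in> spectrum (H_op \<mu>)"
proof (rule ccontr)
  assume "\<not> ?thesis"
  then have res: "complex_of_real m \<in> resolvent_set (H_op \<mu>)" by (simp add: spectrum_def)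
  then obtain C where C: "\<And>f h. (f, h) \<in> H_op \<mu> \<Longrightarrow> L2_norm f \<le> C * L2_norm (\<lambda>x. h x - of_real m * f x)"
    unfolding resolvent_set_def by blast
  \<comment> \<open>The constant from \<open>resolvent_set\<close> may have either sign;
    \<open>D\<close> is a positive one.\<close>
  define D where "D = \<bar>C\<bar> + 1"
  have D: "0 < D" "C \<le> D" by (auto simp: D_def)
  \<comment> \<open>The factor \<open>1 / (2 * D)\<close> makes the final chain end in
    \<open>(sqn lborel f)\<^sup>2 / 2\<close>.\<close>
  obtain f where f: "f \<in> H1" and fpos: "0 < sqn lborel f" and f_small: "energy m f \<le> 1 / (2 * D) * sqn lborel f"
    using approx[of "1 / (2 * D)"] D by auto
  have sf: "sqint lborel f" using f by (rule H1_sqint)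
  then have "f \<in> L2" by (simp add: L2_iff_sqint)
  then obtain g h where gh: "(g, h) \<in> H_op \<mu>" and eq: "AE x in lborel. h x - of_real m * g x = f x"
    using res unfolding resolvent_set_def by blast
  let ?k = "\<lambda>x. h x - of_real m * g x"
  have k: "sqint lborel ?k" by (rule H_op_shifted(1)[OF gh])
  have g: "g \<in> H1" using gh by (simp add: H_op_iff)
  have sg: "sqint lborel g" using g by (rule H1_sqint)
  have kf: "sqn lborel ?k = sqn lborel f"
    by (rule sqn_cong_AE[OF eq sqintD[OF k] sqintD[OF sf]])
  have weak: "shifted_form m g v = ip lborel f v" if v: "v \<in> H1" for v
    using H_op_shifted(2)[OF gh v, of m]
      ip_cong_AE[OF eq _ sqintD[OF k] sqintD[OF sf], of v v] sqintD[OF H1_sqint(1)[OF v]] by simp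
  have "energy m g = Re (ip lborel f g)"
    using weak[OF g] by (metis Re_complex_of_real shifted_form_self)
  also have "\<dots> \<le> cmod (ip lborel f g)" by (rule complex_Re_le_cmod)
  also have "\<dots> \<le> L2_norm f * L2_norm g" unfolding L2_norm_eq by (rule cmod_ip_le[OF sf sg])
  also have "\<dots> \<le> L2_norm f * (D * L2_norm f)"
  proof (rule mult_left_mono)
    have "L2_norm g \<le> C * L2_norm f" using C[OF gh] kf by (simp add: L2_norm_eq)
    also have "\<dots> \<le> D * L2_norm f" using D by (intro mult_right_mono) (auto simp: L2_norm_eq)
    finally show "L2_norm g \<le> D * L2_norm f" .
  qed (simp add: L2_norm_eq)
  also have "\<dots> = D * sqn lborel f" by (simp add: L2_norm_eq mult.left_commute)
  finally have eg: "energy m g \<le> D * sqn lborel f" .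
  have "(sqn lborel f)\<^sup>2 = (cmod (shifted_form m g f))\<^sup>2"
    by (simp add: weak[OF f] ip_self)
  also have "\<dots> \<le> energy m g * energy m f"
    by (rule shifted_form_Cauchy_Schwarz[OF nonneg g f])
  also have "\<dots> \<le> (D * sqn lborel f) * (1 / (2 * D) * sqn lborel f)"
    using eg f_small nonneg[OF f] D fpos by (intro mult_mono) auto
  also have "\<dots> = (sqn lborel f)\<^sup>2 / 2" using D by (simp add: power2_eq_square)
  finally show False using fpos by simp
qed

text \<open>The lower bound \<open>L\<close> makes the real \<open>Inf\<close> of the Rayleigh
  quotients a true infimum, and \<open>approximate_minimum_in_spectrum\<close> places it in the
  spectrum.\<close>

lemma lambda1_le_Rayleigh_quotient:
  assumes lower: "\<And>f. f \<in> H1 \<Longrightarrow> 0 \<le> energy L f"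
    and f: "f \<in> H1" "0 < sqn lborel f"
  shows "lambda1 \<mu> \<le> ereal (energy 0 f / sqn lborel f)"
proof -
  define R where "R = (\<lambda>f. energy 0 f / sqn lborel f) ` {f \<in> H1. 0 < sqn lborel f}"
  have e0: "energy t f = energy 0 f - t * sqn lborel f" for t f by (simp add: energy_def)
  have bdd: "bdd_below R"
    unfolding R_def
  proof (rule bdd_belowI2)
    fix f assume "f \<in> {f \<in> H1. 0 < sqn lborel f}"
    then show "L \<le> energy 0 f / sqn lborel f"
      using lower[of f] e0[of L f] by (simp add: field_simps)
  qed
  have ne: "R \<noteq> {}" using f by (auto simp: R_def)
  define m where "m = Inf R"
  have "complex_of_real m \<in> spectrum (H_op \<mu>)"
  proof (rule approximate_minimum_in_spectrum)
    fix v assume v: "v \<in> H1"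
    show "0 \<le> energy m v"
    proof (cases "sqn lborel v = 0")
      \<comment> \<open>A function that vanishes almost everywhere has no Rayleigh quotient, but its
        energy does not depend on the shift.\<close>
      case True
      then show ?thesis using lower[OF v] e0[of m v] e0[of L v] by simp
    next
      case False
      then have "0 < sqn lborel v" using sqn_nonneg[of lborel v] by linarith
      moreover from this v have "m \<le> energy 0 v / sqn lborel v"
        unfolding m_def using bdd by (intro cInf_lower) (auto simp: R_def)
      ultimately show ?thesis using e0[of m v] by (simp add: field_simps)
    qed
  next
    fix \<delta> :: real assume "0 < \<delta>"
    then obtain v where "v \<in> H1" "0 < sqn lborel v" "energy 0 v / sqn lborel v < m + \<delta>"
      using cInf_lessD[OF ne, of "m + \<delta>"] by (auto simp: m_def R_def)
    then show "\<exists>f\<in>H1. 0 < sqn lborel f \<and> energy m f \<le> \<delta> * sqn lborel f"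
      using e0[of m v] by (intro bexI[of _ v]) (auto simp: field_simps)
  qed
  then have "lambda1 \<mu> \<le> ereal m" unfolding lambda1_def by (intro INF_lower) simp
  also have "m \<le> energy 0 f / sqn lborel f"
    unfolding m_def using bdd f by (intro cInf_lower) (auto simp: R_def)
  finally show ?thesis by simp
qed

end

section \<open>The test function\<close>

lemma has_bochner_integral_exp_abs:
  fixes x d :: real
  assumes "0 < d"
  shows "has_bochner_integral lborel (\<lambda>y. exp (- 2 * \<bar>y - x\<bar> / d)) d"
proof -
  have "has_bochner_integral lborel (\<lambda>s::real. indicator {0..} s *\<^sub>R exp (- 2 * \<bar>s\<bar>)) (1 / 2)"
  proof (rule has_bochner_integral_nn_integral)
    have "(\<integral>\<^sup>+s. ennreal (indicator {0..} s * exp (- 2 * s)) \<partial>lborel) = ennreal (1 / 2)"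
      using has_integral_exp_minus_to_infinity[of 2 0]
      by (intro nn_integral_has_integral_lebesgue) auto
    then show "(\<integral>\<^sup>+s. ennreal (indicator {0..} s *\<^sub>R exp (- 2 * \<bar>s::real\<bar>)) \<partial>lborel) = ennreal (1 / 2)"
      by (rule trans[rotated]) (auto intro!: nn_integral_cong simp: indicator_def)
  qed auto
  from has_bochner_integral_even_function[OF this]
  have 1: "has_bochner_integral lborel (\<lambda>s::real. exp (- 2 * \<bar>s\<bar>)) 1" by simp
  \<comment> \<open>The substitution \<open>y = x + d * s\<close> contributes the factor
    \<open>d\<close>.\<close>
  show ?thesis
    using assms 1 by (subst lborel_has_bochner_integral_real_affine_iff[where c = d and t = x])
      (simp_all add: abs_mult)
qed

lemma exp_abs_H1:
  fixes x d :: real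
  assumes "0 < d"
  defines "f \<equiv> \<lambda>y. complex_of_real (exp (- \<bar>y - x\<bar> / d))"
  shows "f \<in> H1" "sqn lborel f = d" "sqn lborel (H1_deriv f) = 1 / d"
proof -
  \<comment> \<open>At the kink \<open>y = x\<close> the convention \<open>sgn 0 = 0\<close> puts
    \<open>g x = 0\<close>. This one point is null for the norm and is the exceptional set in the
    fundamental theorem of calculus.\<close>
  define g where "g y = complex_of_real (- sgn (y - x) / d * exp (- \<bar>y - x\<bar> / d))" for y
  have f2: "(cmod (f y))\<^sup>2 = exp (- 2 * \<bar>y - x\<bar> / d)" for y
    by (simp add: f_def norm_mult flip: exp_double)
  have ae: "AE y in lborel. (cmod (g y))\<^sup>2 = exp (- 2 * \<bar>y - x\<bar> / d) / d\<^sup>2"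
    using AE_lborel_singleton[of x]
    by eventually_elim
      (auto simp: g_def norm_mult norm_divide power_mult_distrib power_divide sgn_if simp flip: exp_double)
  have fm: "f \<in> borel_measurable borel" unfolding f_def by measurable
  have gm: "g \<in> borel_measurable borel" unfolding g_def sgn_if by measurable
  note I = has_bochner_integral_exp_abs[OF assms(1), of x]
  have sf: "sqint lborel f" unfolding sqint_def f2 using fm I by (auto simp: has_bochner_integral_iff)
  show sfd: "sqn lborel f = d" unfolding sqn_def f2 using I by (auto simp: has_bochner_integral_iff)
  have I2: "has_bochner_integral lborel (\<lambda>y. (cmod (g y))\<^sup>2) (d / d\<^sup>2)"
    using has_bochner_integral_divide_zero[OF I, of "d\<^sup>2"] gm
    by (subst has_bochner_integral_cong_AE[OF _ _ ae]) auto
  have sg: "sqint lborel g" unfolding sqint_def using gm I2 by (auto simp: has_bochner_integral_iff)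
  have fg: "has_L2_deriv f g"
    unfolding has_L2_deriv_def L2_iff_sqint
  proof (intro conjI sg allI impI)
    fix a b :: real assume "a \<le> b"
    have "(g has_integral (f b - f a)) {a..b}"
    proof (rule fundamental_theorem_of_calculus_strong[OF _ \<open>a \<le> b\<close>, of "{x}"])
      show "continuous_on {a..b} f"
        unfolding f_def using assms(1) by (intro continuous_intros) auto
      fix y assume "y \<in> {a..b} - {x}"
      then have "y < x \<or> x < y" by auto
      then have "((\<lambda>y. exp (- \<bar>y - x\<bar> / d)) has_real_derivative (- sgn (y - x) / d * exp (- \<bar>y - x\<bar> / d))) (at y)"
      proof
        assume "x < y"
        have "((\<lambda>y. exp (- (y - x) / d)) has_real_derivative (- sgn (y - x) / d * exp (- \<bar>y - x\<bar> / d))) (at y)"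
          using \<open>x < y\<close> assms(1) by (auto intro!: derivative_eq_intros)
        then show ?thesis
          by (rule has_field_derivative_transform_within_open[of _ _ _ "{x<..}"]) (use \<open>x < y\<close> in auto)
      next
        assume "y < x"
        have "((\<lambda>y. exp (- (x - y) / d)) has_real_derivative (- sgn (y - x) / d * exp (- \<bar>y - x\<bar> / d))) (at y)"
          using \<open>y < x\<close> assms(1) by (auto intro!: derivative_eq_intros)
        then show ?thesis
          by (rule has_field_derivative_transform_within_open[of _ _ _ "{..<x}"]) (use \<open>y < x\<close> in auto)
      qed
      then show "(f has_vector_derivative g y) (at y)"
        unfolding f_def g_def has_real_derivative_iff_has_vector_derivative
        by (rule bounded_linear.has_vector_derivative[OF bounded_linear_of_real])
    qed simp
    then show "f b - f a = (LINT t:{a..b}|lborel. g t)"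
      using set_borel_integral_eq_integral(2)[OF L2_set_integrable[OF sg, of a b]]
      by (simp add: integral_unique)
  qed
  show fH: "f \<in> H1" by (rule H1I[OF sf fg])
  have "sqn lborel (H1_deriv f) = sqn lborel g"
    by (rule sqn_cong_AE[OF H1_deriv_AE[OF fg fH] sqintD sqintD]) (intro H1_sqint fH sg)+
  also have "\<dots> = 1 / d"
    unfolding sqn_def using I2 by (simp add: has_bochner_integral_iff power2_eq_square)
  finally show "sqn lborel (H1_deriv f) = 1 / d" .
qed

section \<open>Otelbaev function and spectral bounds\<close>

text \<open>The uniform \<open>d\<close> makes the set in \<open>otelbaev\<close> nonempty at every
  \<open>x\<close> and gives the form bound on H^1.\<close>

lemma brinck_small_interval:
  assumes sets: "sets \<mu> = sets borel" and "brinck \<mu>" and "0 < \<alpha>"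
  shows "\<exists>d>0. \<forall>x. emeasure \<mu> (Delta x d) < ennreal (1 / (\<alpha> * d))"
proof -
  obtain C where C: "0 < C" "\<And>x. emeasure \<mu> {x..x + 1} < ennreal C"
    using assms(2) unfolding brinck_def by blast
  \<comment> \<open>\<open>d \<le> 1\<close> fits \<open>Delta x d\<close> into a unit interval, and
    \<open>d \<le> 1 / (\<alpha> * C)\<close> lifts the threshold \<open>1 / (\<alpha> * d)\<close>
    to at least \<open>C\<close>.\<close>
  define d where "d = min 1 (1 / (\<alpha> * C))"
  have d: "0 < d" "d \<le> 1" using C \<open>0 < \<alpha>\<close> by (auto simp: d_def)
  have "d * (\<alpha> * C) \<le> 1 / (\<alpha> * C) * (\<alpha> * C)"
    using C \<open>0 < \<alpha>\<close> by (intro mult_right_mono) (auto simp: d_def)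
  then have Cd: "C \<le> 1 / (\<alpha> * d)" using d C \<open>0 < \<alpha>\<close> by (simp add: field_simps)
  have "emeasure \<mu> (Delta x d) < ennreal (1 / (\<alpha> * d))" for x
  proof -
    have "emeasure \<mu> (Delta x d) \<le> emeasure \<mu> {x - d / 2..x - d / 2 + 1}"
      using d sets by (intro emeasure_mono) (auto simp: Delta_def)
    also have "\<dots> < ennreal C" by (rule C)
    also have "\<dots> \<le> ennreal (1 / (\<alpha> * d))" by (intro ennreal_leI Cd)
    finally show ?thesis .
  qed
  with d show ?thesis by blast
qed

lemma otelbaev_bdd_below:
  "bdd_below {1 / d\<^sup>2 | d. 0 < d \<and> emeasure \<mu> (Delta x d) < ennreal (1 / (\<alpha> * d))}"
  by (rule bdd_belowI[of _ 0]) auto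

lemma emeasure_Delta_ge:
  assumes "0 < d" "1 / d\<^sup>2 < otelbaev \<mu> \<alpha> x"
  shows "ennreal (1 / (\<alpha> * d)) \<le> emeasure \<mu> (Delta x d)"
proof (rule ccontr)
  assume "\<not> ?thesis"
  then have "otelbaev \<mu> \<alpha> x \<le> 1 / d\<^sup>2"
    unfolding otelbaev_def using assms(1) by (intro cInf_lower otelbaev_bdd_below) auto
  then show False using assms(2) by simp
qed

text \<open>Shrinking \<open>d\<close> lowers the measure and raises the threshold, so every value
  strictly above the infimum comes from an admissible \<open>d\<close>.\<close>

lemma emeasure_Delta_less:
  assumes sets: "sets \<mu> = sets borel" and "brinck \<mu>" "0 < \<alpha>" "0 < d" "otelbaev \<mu> \<alpha> x < 1 / d\<^sup>2"
  shows "emeasure \<mu> (Delta x d) < ennreal (1 / (\<alpha> * d))"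
proof -
  have "{1 / d\<^sup>2 | d. 0 < d \<and> emeasure \<mu> (Delta x d) < ennreal (1 / (\<alpha> * d))} \<noteq> {}"
    using brinck_small_interval[OF assms(1-3)] by blast
  from cInf_lessD[OF this assms(5)[unfolded otelbaev_def]]
  obtain e where e: "0 < e" "emeasure \<mu> (Delta x e) < ennreal (1 / (\<alpha> * e))" "1 / e\<^sup>2 < 1 / d\<^sup>2"
    by blast
  then have "d\<^sup>2 < e\<^sup>2" using \<open>0 < d\<close> by (simp add: field_simps)
  then have de: "d < e" using e(1) by (intro power2_less_imp_less[of d e]) auto
  have "emeasure \<mu> (Delta x d) \<le> emeasure \<mu> (Delta x e)"
    using de sets by (intro emeasure_mono) (auto simp: Delta_def)
  also note e(2)
  also have "ennreal (1 / (\<alpha> * e)) \<le> ennreal (1 / (\<alpha> * d))"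
    using de assms by (intro ennreal_leI divide_left_mono) auto
  finally show ?thesis .
qed

text \<open>Nonemptiness matters, since the real \<open>Inf\<close> of the empty set is unspecified.
  The bound removes the absolute value in \<open>sup_norm\<close>.\<close>

lemma otelbaev_nonneg:
  assumes "sets \<mu> = sets borel" "brinck \<mu>" "0 < \<alpha>"
  shows "0 \<le> otelbaev \<mu> \<alpha> x"
  unfolding otelbaev_def using brinck_small_interval[OF assms] by (intro cInf_greatest) auto

lemma sup_norm_le_iff: "sup_norm q \<le> c \<longleftrightarrow> (\<forall>x. ereal \<bar>q x\<bar> \<le> c)"
  by (simp add: sup_norm_def SUP_le_iff)

section \<open>The two bounds on \<open>lambda1\<close>\<close>

context
  fixes \<mu> :: "real measure"
  assumes sets: "sets \<mu> = sets borel" and brinck: "brinck \<mu>"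
begin

interpretation H1_form \<mu>
proof
  fix f assume f: "f \<in> H1"
  obtain d where d: "0 < d" "\<And>x. emeasure \<mu> (Delta x d) < ennreal (1 / (2 * d))"
    using brinck_small_interval[OF sets brinck, of 2] by auto
  show "sqint \<mu> f"
    by (rule sqn_le_of_small_measure(1)[OF sets d(1) _ H1_sqint(1)[OF f] H1_deriv_has_L2_deriv[OF f]])
      (intro less_imp_le d)
qed

text \<open>The \<open>1 / 3\<close> is what remains of the derivative term after
  \<open>\<mu>\<close> has taken \<open>2 / 3\<close>. It gives coercivity for \<open>t\<close>
  below \<open>- 2 / d\<^sup>2\<close> and semiboundedness at that value.\<close>

lemma energy_lower_bound:
  assumes "0 < d" "\<And>x. emeasure \<mu> (Delta x d) < ennreal (1 / (2 * d))" "f \<in> H1"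
  shows "1 / 3 * sqn lborel (H1_deriv f) - (2 / d\<^sup>2 + t) * sqn lborel f \<le> energy t f"
  using sqn_le_of_small_measure(2)[OF sets assms(1) less_imp_le[OF assms(2)] H1_sqint(1)[OF assms(3)]
      H1_deriv_has_L2_deriv[OF assms(3)]]
  by (simp add: energy_def algebra_simps)

lemma lambda1_ge: "- 4 * sup_norm (otelbaev \<mu> 2) \<le> lambda1 \<mu>"
  unfolding lambda1_def
proof (rule INF_greatest, rule ccontr)
  fix t assume t: "t \<in> {t. complex_of_real t \<in> spectrum (H_op \<mu>)}"
    and "\<not> - 4 * sup_norm (otelbaev \<mu> 2) \<le> ereal t"
  then have less: "ereal t < - 4 * sup_norm (otelbaev \<mu> 2)" by simp
  have ub: "ereal \<bar>otelbaev \<mu> 2 x\<bar> \<le> sup_norm (otelbaev \<mu> 2)" for x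
    using sup_norm_le_iff by blast
  \<comment> \<open>The norm is finite: \<open>\<infinity>\<close> would make the left-hand bound
    \<open>- \<infinity>\<close>, with no real \<open>t\<close> below it.\<close>
  obtain r where r: "sup_norm (otelbaev \<mu> 2) = ereal r"
    using less ub[of 0] by (cases "sup_norm (otelbaev \<mu> 2)") auto
  have q: "otelbaev \<mu> 2 x \<le> r" for x using ub[of x] unfolding r by simp
  have "0 \<le> r" using q[of 0] otelbaev_nonneg[OF sets brinck, of 2 0] by simp
  have tr: "t < - 4 * r" using less by (simp add: r)
  \<comment> \<open>The midpoint of \<open>r\<close> and \<open>- t / 2\<close>, in this order since
    \<open>t < - 4 * r \<le> - 2 * r\<close>. Exceeding \<open>r\<close> makes all intervals of
    length \<open>1 / sqrt k\<close> small; staying below \<open>- t / 2\<close> leaves a positive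
    coefficient for \<open>sqn lborel f\<close>.\<close>
  define k where "k = (r - t / 2) / 2"
  have k: "0 < k" "r < k" "2 * k < - t" using tr \<open>0 \<le> r\<close> by (auto simp: k_def)
  define d where "d = 1 / sqrt k"
  have d: "0 < d" "1 / d\<^sup>2 = k" using k by (auto simp: d_def power_divide)
  have small: "emeasure \<mu> (Delta x d) < ennreal (1 / (2 * d))" for x
    by (rule emeasure_Delta_less[OF sets brinck _ d(1)]) (use q[of x] k d in auto)
  have "complex_of_real t \<in> resolvent_set (H_op \<mu>)"
  proof (rule coercive_imp_resolvent_set)
    define c where "c = min (1 / 3) (- t - 2 * k)"
    show "0 < c" using k by (simp add: c_def)
    have c: "c \<le> 1 / 3" "c \<le> - t - 2 * k" unfolding c_def by (rule min.cobounded1 min.cobounded2)+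
    fix f assume f: "f \<in> H1"
    have "c * sqn lborel (H1_deriv f) \<le> 1 / 3 * sqn lborel (H1_deriv f)"
      "c * sqn lborel f \<le> (- t - 2 * k) * sqn lborel f"
      by (intro mult_right_mono c sqn_nonneg)+
    moreover have "2 / d\<^sup>2 = 2 * k" using d(2) by simp
    ultimately show "c * (sqn lborel (H1_deriv f) + sqn lborel f) \<le> energy t f"
      using energy_lower_bound[OF d(1) small f, of t] by (simp add: algebra_simps)
  qed
  then show False using t by (simp add: spectrum_def)
qed

text \<open>The case \<open>m = 0\<close> gives \<open>lambda1 \<mu> \<le> 1 / d\<^sup>2\<close> for
  every \<open>d\<close>, which settles the points where the Otelbaev function vanishes.\<close>

lemma lambda1_le_test_function:
  assumes "0 < d" "ennreal m \<le> emeasure \<mu> (Delta x d)" "0 \<le> m"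
  shows "lambda1 \<mu> \<le> ereal ((1 / d - m / exp 1) / d)"
proof -
  define f where "f y = complex_of_real (exp (- \<bar>y - x\<bar> / d))" for y
  have f: "f \<in> H1" "sqn lborel f = d" "sqn lborel (H1_deriv f) = 1 / d"
    using exp_abs_H1[OF assms(1), of x] by (auto simp: f_def[abs_def])
  have "ennreal (exp (- 1) * m) \<le> ennreal (exp (- 1)) * emeasure \<mu> (Delta x d)"
    using assms by (simp add: ennreal_mult mult_left_mono)
  also have "\<dots> = (\<integral>\<^sup>+y. ennreal (exp (- 1)) * indicator (Delta x d) y \<partial>\<mu>)"
    by (rule nn_integral_cmult_indicator[symmetric]) (simp add: sets Delta_def)
  also have "\<dots> \<le> (\<integral>\<^sup>+y. ennreal ((cmod (f y))\<^sup>2) \<partial>\<mu>)"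
  proof (rule nn_integral_mono)
    fix y
    have "exp (- 1) \<le> (cmod (f y))\<^sup>2" if "y \<in> Delta x d"
    proof -
      have "\<bar>y - x\<bar> \<le> d / 2"
      proof (rule abs_leI)
        show "y - x \<le> d / 2" using that unfolding Delta_def atLeastAtMost_iff by argo
        show "- (y - x) \<le> d / 2" using that unfolding Delta_def atLeastAtMost_iff by argo
      qed
      then have "- 1 \<le> 2 * (- \<bar>y - x\<bar> / d)" using assms(1) by (simp add: field_simps)
      then have "exp (- 1) \<le> exp (2 * (- \<bar>y - x\<bar> / d))" by (simp only: exp_le_cancel_iff)
      also have "\<dots> = (cmod (f y))\<^sup>2" by (simp only: exp_double f_def norm_of_real abs_exp_cancel)
      finally show ?thesis .
    qed
    then show "ennreal (exp (- 1)) * indicator (Delta x d) y \<le> ennreal ((cmod (f y))\<^sup>2)"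
      by (auto simp: indicator_def intro: ennreal_leI)
  qed
  also have "\<dots> = ennreal (sqn \<mu> f)" by (rule sqint_nn_integral[OF H1_sqint_measure[OF f(1)]])
  finally have "m / exp 1 \<le> sqn \<mu> f" by (simp add: exp_minus field_simps)
  then have "energy 0 f / sqn lborel f \<le> (1 / d - m / exp 1) / d"
    using assms(1) by (simp add: energy_def f divide_right_mono)
  moreover have "lambda1 \<mu> \<le> ereal (energy 0 f / sqn lborel f)"
  proof -
    \<comment> \<open>This scale serves only for semiboundedness of the form and is unrelated to
      \<open>d\<close>.\<close>
    obtain e where e: "0 < e" "\<And>x. emeasure \<mu> (Delta x e) < ennreal (1 / (2 * e))"
      using brinck_small_interval[OF sets brinck, of 2] by auto
    show ?thesis
    proof (rule lambda1_le_Rayleigh_quotient)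
      fix v assume "v \<in> H1"
      from energy_lower_bound[OF e this, of "- (2 / e\<^sup>2)"]
      have "1 / 3 * sqn lborel (H1_deriv v) \<le> energy (- (2 / e\<^sup>2)) v" by simp
      then show "0 \<le> energy (- (2 / e\<^sup>2)) v" using sqn_nonneg[of lborel "H1_deriv v"] by linarith
    qed (use f assms(1) in auto)
  qed
  ultimately show ?thesis using order_trans by fastforce
qed

lemma lambda1_le: "lambda1 \<mu> \<le> - (1 / 4) * sup_norm (otelbaev \<mu> (inverse (pi\<^sup>2 + 3 / 4)))"
proof -
  let ?\<alpha> = "inverse (pi\<^sup>2 + 3 / 4)"
  have \<alpha>: "0 < ?\<alpha>" by (simp add: add_pos_pos)
  have pw: "lambda1 \<mu> \<le> ereal (- otelbaev \<mu> ?\<alpha> x / 4)" for x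
  proof (rule ccontr)
    define q where "q = otelbaev \<mu> ?\<alpha> x"
    assume "\<not> ?thesis"
    then have "ereal (- q / 4) < lambda1 \<mu>" by (simp add: q_def)
    from ereal_dense2[OF this] obtain y where y: "- q / 4 < y" "ereal y < lambda1 \<mu>" by auto
    have "0 \<le> q" unfolding q_def by (rule otelbaev_nonneg[OF sets brinck \<alpha>])
    then consider "q = 0" | "0 < q" by linarith
    then show False
    proof cases
      \<comment> \<open>No interval of large measure is at hand; a test function spread out until
        \<open>1 / d\<^sup>2 = y\<close> already contradicts the choice of \<open>y\<close>.\<close>
      case 1
      define d where "d = 1 / sqrt y"
      have "0 < y" using y 1 by simp
      then have d: "0 < d" "1 / d / d = y" by (auto simp: d_def)
      from lambda1_le_test_function[OF d(1), of 0 x] y(2) d(2) show False by simp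
    next
      case 2
      \<comment> \<open>Large measure is guaranteed only for \<open>1 / d\<^sup>2\<close> strictly
        below \<open>q\<close>. The midpoint of \<open>q\<close> and \<open>- 4 * y\<close> lies
        below \<open>q\<close> and keeps \<open>- k / 4 < y\<close>; the maximum with
        \<open>q / 2\<close> makes \<open>k\<close> positive.\<close>
      define k where "k = max (q / 2) ((q - 4 * y) / 2)"
      have k: "0 < k" "k < q" using 2 y(1) by (auto simp: k_def)
      have "(q - 4 * y) / 2 \<le> k" unfolding k_def by (rule max.cobounded2)
      then have ky: "- k / 4 < y" using y(1) by simp
      define d where "d = 1 / sqrt k"
      have d: "0 < d" "1 / d\<^sup>2 = k" using k by (auto simp: d_def power_divide)
      define m where "m = 1 / (?\<alpha> * d)"
      have "ennreal m \<le> emeasure \<mu> (Delta x d)"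
        unfolding m_def by (rule emeasure_Delta_ge[OF d(1)]) (use k d in \<open>auto simp: q_def\<close>)
      moreover have m: "m = (pi\<^sup>2 + 3 / 4) / d"
        unfolding m_def by (simp only: divide_inverse inverse_mult_distrib inverse_inverse_eq mult_1)
      moreover have "0 \<le> m" using d m by simp
      ultimately have "lambda1 \<mu> \<le> ereal ((1 / d - m / exp 1) / d)"
        by (intro lambda1_le_test_function d)
      also have "(1 / d - m / exp 1) / d = k * (1 - (pi\<^sup>2 + 3 / 4) / exp 1)"
      proof -
        have "(1 / d - K / d / E) / d = 1 / d\<^sup>2 * (1 - K / E)" if "0 < E" for K E :: real
          using that d(1) by (simp add: field_simps power2_eq_square)
        from this[OF exp_gt_zero] show ?thesis unfolding m d(2) .
      qed
      also have "\<dots> \<le> k * (- 1 / 4)"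
      proof (rule mult_left_mono)
        \<comment> \<open>The target \<open>- 1 / 4\<close> requires
          \<open>5 / 4 * exp 1 \<le> pi\<^sup>2 + 3 / 4\<close>. The crude bounds
          \<open>pi > 3\<close> and \<open>exp 1 \<le> 3\<close> leave \<open>15 / 4\<close> against
          \<open>39 / 4\<close>.\<close>
        have "3\<^sup>2 \<le> pi\<^sup>2" using pi_gt3 by (intro power_mono) auto
        then have "5 / 4 * exp 1 \<le> pi\<^sup>2 + 3 / 4" using exp_le by simp
        then have "5 / 4 \<le> (pi\<^sup>2 + 3 / 4) / exp 1" by (simp add: pos_le_divide_eq)
        then show "1 - (pi\<^sup>2 + 3 / 4) / exp 1 \<le> - 1 / 4" by linarith
      qed (use k in simp)
      finally have "lambda1 \<mu> \<le> ereal (k * (- 1 / 4))" by simp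
      then have "ereal y < ereal (k * (- 1 / 4))" using y(2) by (rule less_le_trans[rotated])
      then show False using ky by simp
    qed
  qed
  show ?thesis
  \<comment> \<open>The pointwise bounds are collected into the supremum for real
    \<open>lambda1\<close>; \<open>pw\<close> excludes \<open>\<infinity>\<close>, and at
    \<open>- \<infinity>\<close> the claim is trivial.\<close>
  proof (cases "lambda1 \<mu>")
    case (real l)
    have "sup_norm (otelbaev \<mu> ?\<alpha>) \<le> ereal (- 4 * l)"
      unfolding sup_norm_le_iff
    proof
      fix x
      show "ereal \<bar>otelbaev \<mu> ?\<alpha> x\<bar> \<le> ereal (- 4 * l)"
        using pw[of x] otelbaev_nonneg[OF sets brinck \<alpha>, of x] by (simp add: real)
    qed
    moreover have "ereal \<bar>otelbaev \<mu> ?\<alpha> 0\<bar> \<le> sup_norm (otelbaev \<mu> ?\<alpha>)"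
      using sup_norm_le_iff by blast
    ultimately show ?thesis unfolding real by (cases "sup_norm (otelbaev \<mu> ?\<alpha>)") auto
  next
    case PInf
    then show ?thesis using pw[of 0] by simp
  qed simp
qed

end

theorem corollary4p13:
  fixes \<mu> :: "real measure"
  assumes "radon_measure \<mu>" and "brinck \<mu>"
  shows "- 4 * sup_norm (otelbaev \<mu> 2) \<le> lambda1 \<mu>
    \<and> lambda1 \<mu> \<le> - (1 / 4) * sup_norm (otelbaev \<mu> (inverse (pi\<^sup>2 + 3 / 4)))"
proof -
  have "sets \<mu> = sets borel" using assms(1) by (simp add: radon_measure_def)
  then show ?thesis using lambda1_ge lambda1_le assms(2) by blast
qed

end
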